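(* Let $n\ge1$, $0<p<p_n^*$, and let $u$ be a solution of the focusing nonlinear Schrödinger equation $$iu_t+\Delta u=-|u|^pu,\qquad (t,x)\in\mathbb{R}\times\mathbb{R}^n,$$ with momentum $P[u]=0$. Then $u$ cannot be a breather in any of the following regimes: (1) $E[u]>0$ and $p\le 4/n$; (2) $E[u]=0$ and $p\ne 4/n$; (3) $E[u]<0$ and $4/n\le p<p_n^*$.
   Context: The energy critical power is $p_n^*=\infty$ for $n=1,2$ and $p_n^*=\frac{4}{n-2}$ for $n\ge 3$. The conserved energy and momentum are $$E[u]=\|\nabla_x u\|_{L^2}^2-\frac{2}{p+2}\|u\|_{L^{p+2}}^{p+2},\qquad P[u]=\mathrm{Im}\int_{\mathbb{R}^n}\bar u\,\nabla_x u\,dx .$$ Let $Q$ be the ground state, i.e. the unique (up to symmetries) positive radial, exponentially decaying $H^1(\mathbb{R}^n)$ solution of $-\Delta Q+Q-|Q|^pQ=0$. For $\omega>0$ let $Q_\omega(x)=\omega^{1/p}Q(\sqrt{\omega}\,x)$, which solves $-\Delta Q_\omega+\omega Q_\omega-|Q_\omega|^pQ_\omega=0$. Breather (with zero background): a solution $u:\mathbb{R}\times\mathbb{R}^n\to\mathbb{C}$ of the equation for which there exist $\omega,C,\gamma>0$ such that, writing $u(t,x)=e^{i\omega t}\big(Q_\omega(x)+z(t,x)\big)$, the function $z$ is a nontrivial ($z\neq0$) solution of $iz_t-\omega z+\Delta z=-|Q_\omega+z|^p(Q_\omega+z)+|Q_\omega|^pQ_\omega$ and: (i) $u(t+2\pi/\omega,x)=u(t,x)$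 for all $(t,x)\in\mathbb{R}\times\mathbb{R}^n$; (ii) $z(t,\cdot)\in C^\infty(\mathbb{R}^n)\cap H^1(\mathbb{R}^n)$ for all $t\in\mathbb{R}$; (iii) $\sup_{t\in\mathbb{R}}|D_x^\alpha z(t,x)|\le Ce^{-\gamma|x|}$ for all $x\in\mathbb{R}^n$ and all multi-indices $|\alpha|\le 2$.
   Formalization: The solution u is additionally assumed not to be identically zero: u = 0 (with z = −Q_ω) satisfies the definition of a breather with E[u] = 0 and P[u] = 0, so regime (2) is false without this assumption. *)

theory Defs
  imports "HOL-Analysis.Analysis" "HOL-Library.Extended_Real"
begin

section \<open>Differential operators on \<open>real ^ 'n\<close>\<close>

text \<open>Only meaningful at points where \<open>f\<close> is (Frechet) differentiable, which is how it is used.\<close>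

definition pd :: "'n::finite \<Rightarrow> (real ^ 'n \<Rightarrow> 'b::real_normed_vector) \<Rightarrow> real ^ 'n \<Rightarrow> 'b" where
  "pd i f x = frechet_derivative f (at x) (axis i 1)"

text \<open>A multi-index of order \<open>k\<close> is represented by a list of \<open>k\<close> coordinate directions. For
  \<open>C\<^sup>k\<close> functions the order of the directions is irrelevant, so every multi-index is covered.\<close>

fun pd_iter :: "'n::finite list \<Rightarrow> (real ^ 'n \<Rightarrow> 'b::real_normed_vector) \<Rightarrow> real ^ 'n \<Rightarrow> 'b" where
  "pd_iter [] f = f"
| "pd_iter (i # \<alpha>) f = pd i (pd_iter \<alpha> f)"

definition laplacian :: "(real ^ 'n::finite \<Rightarrow> 'b::real_normed_vector) \<Rightarrow> real ^ 'n \<Rightarrow> 'b" where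
  "laplacian f x = (\<Sum>i\<in>UNIV. pd i (pd i f) x)"

fun Ck :: "nat \<Rightarrow> (real ^ 'n::finite \<Rightarrow> 'b::real_normed_vector) \<Rightarrow> bool" where
  "Ck 0 f \<longleftrightarrow> continuous_on UNIV f"
| "Ck (Suc k) f \<longleftrightarrow> (\<forall>x. f differentiable (at x)) \<and> (\<forall>i. Ck k (pd i f))"

definition smooth :: "(real ^ 'n::finite \<Rightarrow> 'b::real_normed_vector) \<Rightarrow> bool" where
  "smooth f \<longleftrightarrow> (\<forall>k. Ck k f)"


section \<open>The Sobolev space \<open>H\<^sup>1\<close>\<close>

definition in_L2 :: "(real ^ 'n::finite \<Rightarrow> 'b::{banach, second_countable_topology}) \<Rightarrow> bool" where
  "in_L2 f \<longleftrightarrow> f \<in> borel_measurable lborel \<and> integrable lborel (\<lambda>x. (norm (f x))\<^sup>2)"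

definition test_function :: "(real ^ 'n::finite \<Rightarrow> real) \<Rightarrow> bool" where
  "test_function \<phi> \<longleftrightarrow> smooth \<phi> \<and> bounded {x. \<phi> x \<noteq> 0}"

definition weak_pd ::
  "'n::finite \<Rightarrow> (real ^ 'n \<Rightarrow> 'b::{banach, second_countable_topology}) \<Rightarrow> (real ^ 'n \<Rightarrow> 'b) \<Rightarrow> bool" where
  "weak_pd i f g \<longleftrightarrow> (\<forall>\<phi>. test_function \<phi> \<longrightarrow>
     (LINT x|lborel. pd i \<phi> x *\<^sub>R f x) = - (LINT x|lborel. \<phi> x *\<^sub>R g x))"

definition in_H1 :: "(real ^ 'n::finite \<Rightarrow> 'b::{banach, second_countable_topology}) \<Rightarrow> bool" where
  "in_H1 f \<longleftrightarrow> in_L2 f \<and> (\<forall>i. \<exists>g. in_L2 g \<and> weak_pd i f g)"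


section \<open>The focusing nonlinear Schroedinger equation\<close>

definition crit_exponent :: "nat \<Rightarrow> ereal" where
  "crit_exponent n = (if n \<le> 2 then \<infinity> else ereal (4 / (real n - 2)))"

definition nonlin :: "real \<Rightarrow> complex \<Rightarrow> complex" where
  "nonlin p w = complex_of_real (norm w powr p) * w"

text \<open>Classical solutions: all derivatives in the equation exist, and it holds at every \<open>(t, x)\<close>.\<close>

definition NLS_solution :: "real \<Rightarrow> (real \<Rightarrow> real ^ 'n::finite \<Rightarrow> complex) \<Rightarrow> bool" where
  "NLS_solution p u \<longleftrightarrow>
     (\<forall>t x. (\<lambda>s. u s x) differentiable (at t)) \<and>
     (\<forall>t. Ck 2 (u t)) \<and>
     (\<forall>t x. \<i> * vector_derivative (\<lambda>s. u s x) (at t) + laplacian (u t) x = - nonlin p (u t x))"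

definition energy :: "real \<Rightarrow> (real ^ 'n::finite \<Rightarrow> complex) \<Rightarrow> real" where
  "energy p f = (LINT x|lborel. (\<Sum>i\<in>UNIV. (norm (pd i f x))\<^sup>2))
     - 2 / (p + 2) * (LINT x|lborel. norm (f x) powr (p + 2))"

definition momentum :: "(real ^ 'n::finite \<Rightarrow> complex) \<Rightarrow> real ^ 'n" where
  "momentum f = (\<chi> i. Im (LINT x|lborel. cnj (f x) * pd i f x))"


section \<open>Ground state and breathers\<close>

definition ground_state :: "real \<Rightarrow> (real ^ 'n::finite \<Rightarrow> real) \<Rightarrow> bool" where
  "ground_state p Q \<longleftrightarrow>
     (\<forall>x. Q x > 0) \<and>
     (\<forall>x y. norm x = norm y \<longrightarrow> Q x = Q y) \<and>
     (\<exists>C>0. \<exists>\<delta>>0. \<forall>x. \<bar>Q x\<bar> \<le> C * exp (- \<delta> * norm x)) \<and>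
     in_H1 Q \<and> Ck 2 Q \<and>
     (\<forall>x. - laplacian Q x + Q x - \<bar>Q x\<bar> powr p * Q x = 0)"

definition rescaled ::
  "real \<Rightarrow> (real ^ 'n::finite \<Rightarrow> real) \<Rightarrow> real \<Rightarrow> real ^ 'n \<Rightarrow> complex" where
  "rescaled p Q \<omega> x = complex_of_real (\<omega> powr (1 / p) * Q (sqrt \<omega> *\<^sub>R x))"

definition perturbation_solution ::
  "real \<Rightarrow> (real ^ 'n::finite \<Rightarrow> real) \<Rightarrow> real \<Rightarrow> (real \<Rightarrow> real ^ 'n \<Rightarrow> complex) \<Rightarrow> bool" where
  "perturbation_solution p Q \<omega> z \<longleftrightarrow>
     (\<forall>t x. (\<lambda>s. z s x) differentiable (at t)) \<and>
     (\<forall>t. Ck 2 (z t)) \<and>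
     (\<forall>t x. \<i> * vector_derivative (\<lambda>s. z s x) (at t) - complex_of_real \<omega> * z t x + laplacian (z t) x
        = - nonlin p (rescaled p Q \<omega> x + z t x) + nonlin p (rescaled p Q \<omega> x))"

definition breather ::
  "real \<Rightarrow> (real ^ 'n::finite \<Rightarrow> real) \<Rightarrow> (real \<Rightarrow> real ^ 'n \<Rightarrow> complex) \<Rightarrow> bool" where
  "breather p Q u \<longleftrightarrow> NLS_solution p u \<and>
     (\<exists>\<omega>>0. \<exists>C>0. \<exists>\<gamma>>0. \<exists>z.
        (\<forall>t x. u t x = exp (\<i> * complex_of_real (\<omega> * t)) * (rescaled p Q \<omega> x + z t x)) \<and>
        perturbation_solution p Q \<omega> z \<and>
        (\<exists>t x. z t x \<noteq> 0) \<and>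
        (\<forall>t x. u (t + 2 * pi / \<omega>) x = u t x) \<and>
        (\<forall>t. smooth (z t) \<and> in_H1 (z t)) \<and>
        (\<forall>\<alpha>. length \<alpha> \<le> 2 \<longrightarrow> (\<forall>t x. norm (pd_iter \<alpha> (z t) x) \<le> C * exp (- \<gamma> * norm x))))"

end

theory Submission
  imports Defs
begin

text \<open>
  Virial argument. For \<open>M(t) = Im \<integral> x \<cdot> u\<^sup>* \<nabla>u\<close> integration by parts (Pohozaev) gives
  \<open>M' = 2 E[u] + (4 - n p) / (p + 2) \<parallel>u\<parallel>\<close>, the norm being \<open>L\<close> of exponent \<open>p + 2\<close>, to the power
  \<open>p + 2\<close>. In each of the three regimes \<open>M'\<close> has a strict sign, whereas \<open>M\<close> is time periodic for
  a breather.

  Spatial derivatives of \<open>u\<close> are not known to be differentiable in time. The energy is therefore only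
  bounded from below: with \<open>w = u(t) - u(s)\<close> one has
  \<open>E(t) - E(s) = \<parallel>\<nabla>w\<parallel>\<^sup>2 + \<phi>(t) - \<phi>(s)\<close> where \<open>\<phi>'(s) = 0\<close>, because \<open>\<phi>\<close> involves only \<open>u(t)\<close>
  paired with fixed functions. Such one-sided bounds at every \<open>s\<close>, together with continuity, make
  \<open>E\<close> constant. In \<open>M(t) - M(s)\<close> the remainder \<open>Im \<integral> w\<^sup>* x \<cdot> \<nabla>w\<close> is of order \<open>|t - s|\<close> to the
  power \<open>3/2\<close>, since \<open>\<parallel>\<nabla>w\<parallel>\<^sup>2 = - Re \<integral> w \<Delta>w\<^sup>* = O(|t - s|)\<close>.
\<close>

text \<open>Two gaps in the hypotheses shape the argument. Decay of a ground state is given only for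
  \<open>Q\<close> itself, while the integrations by parts need it for the first and second
  derivatives; the radial ODE supplies it. And \<open>u\<close> is differentiable in time only
  pointwise in \<open>x\<close>, so only integrals built from the values of \<open>u\<close>, never
  from its gradient, are differentiated in time under the integral sign; the equation bounds the
  time derivative by an envelope uniform in time.

  The virial is an indefinite quadratic form: its remainder has no sign and must be shown to be of
  higher order.

  The derivative of the virial is not shown to be continuous in time, so periodicity is exploited by
  the mean value theorem, at one time, instead of by integration over a period. At that time the
  potential energy has to be positive; conservation of mass guarantees this, since a solution that
  vanishes at one time vanishes always.\<close>

section \<open>Integrability of exponentials and differentiation under the integral sign\<close>

lemma integrable_exp_abs:
  fixes c :: real
  assumes "c > 0"
  shows "integrable lborel (\<lambda>x::real. exp (- c * \<bar>x\<bar>))"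
proof -
  have "(\<lambda>x. exp (- c * x)) absolutely_integrable_on {0..}"
    using assms by (intro nonnegative_absolutely_integrable_1 integrable_on_exp_minus_to_infinity) auto
  then have "integrable lebesgue (\<lambda>x. indicator {0..} x *\<^sub>R exp (- c * x))"
    by (simp add: set_integrable_def)
  then have half: "integrable lborel (\<lambda>x. indicator {0..} x *\<^sub>R exp (- c * x))"
    by (subst (asm) integrable_completion) auto
  then have "integrable lborel (\<lambda>x. indicator {0..} (0 + (-1) * x) *\<^sub>R exp (- c * (0 + (-1) * x)))"
    by (subst lborel_integrable_real_affine_iff) auto
  with half show ?thesis
    by (rule Bochner_Integration.integrable_bound[OF Bochner_Integration.integrable_add])
       (auto simp: indicator_def abs_if)
qed

text \<open>The absolute coordinates sum to at most the dimension times the norm, so the integrand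
  lies below a product of one-dimensional exponentials of rate \<open>d\<close>, whose integral
  factorises.\<close>

lemma integrable_exp_norm:
  fixes c :: real
  assumes "c > 0"
  shows "integrable lborel (\<lambda>x::'a::euclidean_space. exp (- c * norm x))"
proof -
  define d where "d = c / real DIM('a)"
  have d: "d > 0" using assms by (simp add: d_def)
  define g where "g x = exp (- d * \<bar>x\<bar>)" for x :: real
  have g: "g \<in> borel_measurable borel" by (simp add: g_def[abs_def])
  have 1: "(\<integral>\<^sup>+x. ennreal (g x) \<partial>lborel) < \<infinity>"
    using integrable_exp_abs[OF d] by (simp add: integrable_iff_bounded g_def)
  have "(\<integral>\<^sup>+x. ennreal (\<Prod>b\<in>(Basis :: 'a set). g (x \<bullet> b)) \<partial>lborel)
      = (\<integral>\<^sup>+x. (\<Prod>b\<in>(Basis :: 'a set). ennreal (g (x \<bullet> b))) \<partial>lborel)"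
    by (intro nn_integral_cong) (simp add: prod_ennreal g_def)
  also have "\<dots> = (\<Prod>b\<in>(Basis :: 'a set). (\<integral>\<^sup>+x. ennreal (g x) \<partial>lborel))"
    using g by (intro nn_integral_lborel_prod) auto
  also have "\<dots> < \<infinity>" using 1 by (simp add: power_less_top_ennreal)
  finally have "integrable lborel (\<lambda>x::'a. \<Prod>b\<in>Basis. g (x \<bullet> b))"
    using g by (intro integrableI_bounded) (auto simp: g_def prod_nonneg)
  then show ?thesis
  proof (rule Bochner_Integration.integrable_bound)
    show "AE x::'a in lborel. norm (exp (- c * norm x)) \<le> norm (\<Prod>b\<in>Basis. g (x \<bullet> b))"
    proof (rule AE_I2)
      fix x :: 'a
      have "(\<Sum>b\<in>Basis. \<bar>x \<bullet> b\<bar>) \<le> (\<Sum>b\<in>(Basis::'a set). norm x)"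
        by (intro sum_mono Basis_le_norm)
      then have "d * (\<Sum>b\<in>Basis. \<bar>x \<bullet> b\<bar>) \<le> d * (real DIM('a) * norm x)"
        using d by (intro mult_left_mono) auto
      then have "d * (\<Sum>b\<in>Basis. \<bar>x \<bullet> b\<bar>) \<le> c * norm x" by (simp add: d_def)
      moreover have "(\<Prod>b\<in>Basis. g (x \<bullet> b)) = exp (- d * (\<Sum>b\<in>Basis. \<bar>x \<bullet> b\<bar>))"
        by (simp add: g_def exp_sum sum_distrib_left)
      ultimately show "norm (exp (- c * norm x)) \<le> norm (\<Prod>b\<in>Basis. g (x \<bullet> b))" by simp
    qed
  qed simp
qed

text \<open>The mean value inequality turns \<open>bound\<close> into a bound on the difference
  quotients at \<open>s\<close>, and dominated convergence along an arbitrary sequence gives the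
  limit. Pointwise differentiability and a dominating function near \<open>s\<close> suffice, which
  is what a classical solution provides.\<close>

lemma has_field_derivative_integral:
  fixes f :: "real \<Rightarrow> 'a::euclidean_space \<Rightarrow> real"
  assumes int: "\<And>t. integrable lborel (f t)"
    and deriv: "\<And>t x. ((\<lambda>t. f t x) has_real_derivative f' t x) (at t)"
    and meas: "f' s \<in> borel_measurable lborel"
    and bound: "\<And>t x. \<bar>t - s\<bar> \<le> 1 \<Longrightarrow> \<bar>f' t x\<bar> \<le> g x"
    and g: "integrable lborel g"
  shows "((\<lambda>t. LINT x|lborel. f t x) has_real_derivative (LINT x|lborel. f' s x)) (at s)"
proof -
  have "((\<lambda>t. ((LINT x|lborel. f t x) - (LINT x|lborel. f s x)) / (t - s))
      \<longlongrightarrow> (LINT x|lborel. f' s x)) (at s)"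
    unfolding tendsto_at_iff_sequentially
  proof (intro allI impI)
    fix X :: "nat \<Rightarrow> real"
    assume X: "\<forall>i. X i \<in> UNIV - {s}" and lim: "X \<longlonglongrightarrow> s"
    let ?q = "\<lambda>t x. (f t x - f s x) / (t - s)"
    have quot: "\<bar>?q t x\<bar> \<le> g x" if t: "\<bar>t - s\<bar> \<le> 1" "t \<noteq> s" for t x
    proof -
      have "norm (f t x - f s x) \<le> g x * norm (t - s)"
      proof (rule field_differentiable_bound)
        show "convex {s-1..s+1}" by simp
        show "((\<lambda>t. f t x) has_field_derivative f' r x) (at r within {s-1..s+1})" for r
          using deriv has_field_derivative_at_within by blast
        show "norm (f' r x) \<le> g x" if "r \<in> {s-1..s+1}" for r
          using bound[of r x] that by (simp add: abs_le_iff)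
      qed (use t in \<open>auto simp: abs_le_iff\<close>)
      then show ?thesis using t by (simp add: divide_le_eq)
    qed
    \<comment> \<open>The dominating function is valid only within distance 1 of \<open>s\<close>,
      so the first \<open>N\<close> terms of the sequence are skipped and put back by
      \<open>LIMSEQ_offset\<close>.\<close>
    have ev: "\<forall>\<^sub>F i in sequentially. \<bar>X i - s\<bar> \<le> 1"
      using lim[unfolded tendsto_iff, rule_format, of 1] by (auto simp: dist_real_def elim: eventually_mono)
    then obtain N where N: "\<And>i. i \<ge> N \<Longrightarrow> \<bar>X i - s\<bar> \<le> 1"
      by (auto simp: eventually_sequentially)
    have "(\<lambda>i. LINT x|lborel. ?q (X (i + N)) x) \<longlonglongrightarrow> (LINT x|lborel. f' s x)"
    proof (rule integral_dominated_convergence[OF meas _ g])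
      show "?q (X (i + N)) \<in> borel_measurable lborel" for i
        using int by (auto dest!: borel_measurable_integrable)
      show "AE x in lborel. (\<lambda>i. ?q (X (i + N)) x) \<longlonglongrightarrow> f' s x"
      proof (rule AE_I2)
        fix x
        have "((\<lambda>t. ?q t x) \<longlongrightarrow> f' s x) (at s)"
          using deriv[of x s] by (simp add: has_field_derivative_iff)
        then have "(\<lambda>i. ?q (X i) x) \<longlonglongrightarrow> f' s x"
          using X lim unfolding tendsto_at_iff_sequentially comp_def by blast
        then show "(\<lambda>i. ?q (X (i + N)) x) \<longlonglongrightarrow> f' s x" by (rule LIMSEQ_ignore_initial_segment)
      qed
      show "AE x in lborel. norm (?q (X (i + N)) x) \<le> g x" for i
      proof (rule AE_I2)
        fix x show "norm (?q (X (i + N)) x) \<le> g x"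
          using quot[of "X (i + N)" x] N[of "i + N"] X by auto
      qed
    qed
    then have "(\<lambda>i. LINT x|lborel. ?q (X i) x) \<longlonglongrightarrow> (LINT x|lborel. f' s x)"
      by (rule LIMSEQ_offset)
    moreover have "(LINT x|lborel. ?q t x) = ((LINT x|lborel. f t x) - (LINT x|lborel. f s x)) / (t - s)" for t
      using int by (simp add: Bochner_Integration.integral_diff)
    ultimately show "((\<lambda>t. ((LINT x|lborel. f t x) - (LINT x|lborel. f s x)) / (t - s)) \<circ> X)
        \<longlonglongrightarrow> (LINT x|lborel. f' s x)"
      by (simp only: comp_def)
  qed
  then show ?thesis by (simp add: has_field_derivative_iff)
qed

section \<open>Exponentially decaying functions\<close>

text \<open>The rate is existential so that the class is closed under multiplication by coordinates,
  which costs half of the rate. No sign is asked of \<open>C\<close>; \<open>exp_decayE\<close>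
  delivers a positive one.\<close>

definition exp_decay :: "('a::real_normed_vector \<Rightarrow> 'b::real_normed_vector) \<Rightarrow> bool" where
  "exp_decay f \<longleftrightarrow> (\<exists>C. \<exists>c>0. \<forall>x. norm (f x) \<le> C * exp (- c * norm x))"

lemma exp_decayI: "c > 0 \<Longrightarrow> (\<And>x. norm (f x) \<le> C * exp (- c * norm x)) \<Longrightarrow> exp_decay f"
  unfolding exp_decay_def by blast

lemma exp_decayE:
  assumes "exp_decay f"
  obtains C c where "C > 0" "c > 0" "\<And>x. norm (f x) \<le> C * exp (- c * norm x)"
proof -
  obtain C c where c: "c > 0" and b: "\<And>x. norm (f x) \<le> C * exp (- c * norm x)"
    using assms by (auto simp: exp_decay_def)
  have "C * exp (- c * norm x) \<le> (\<bar>C\<bar> + 1) * exp (- c * norm x)" for x :: 'a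
    by (intro mult_right_mono) auto
  with b have "norm (f x) \<le> (\<bar>C\<bar> + 1) * exp (- c * norm x)" for x
    by (meson order_trans)
  with c show ?thesis by (intro that[of "\<bar>C\<bar> + 1" c]) auto
qed

lemma exp_decay_bounded:
  assumes "exp_decay f"
  obtains B where "B > 0" "\<And>x. norm (f x) \<le> B"
proof -
  obtain C c where *: "C > 0" "c > 0" "\<And>x. norm (f x) \<le> C * exp (- c * norm x)"
    using exp_decayE[OF assms] by blast
  have "C * exp (- c * norm x) \<le> C * 1" for x :: 'a
    using * by (intro mult_left_mono) auto
  then have "norm (f x) \<le> C" for x
    using *(3)[of x] order_trans by fastforce
  with * show ?thesis by (intro that[of C]) auto
qed

lemma exp_decay_mono:
  assumes "exp_decay f" "\<And>x. norm (g x) \<le> B * norm (f x)"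
  shows "exp_decay g"
proof -
  obtain C c where *: "C > 0" "c > 0" "\<And>x. norm (f x) \<le> C * exp (- c * norm x)"
    using exp_decayE[OF assms(1)] by blast
  show ?thesis
  proof (rule exp_decayI[of c _ "\<bar>B\<bar> * C"])
    fix x
    have "B * norm (f x) \<le> \<bar>B\<bar> * (C * exp (- c * norm x))"
      using * by (intro mult_mono) auto
    then show "norm (g x) \<le> \<bar>B\<bar> * C * exp (- c * norm x)"
      using assms(2)[of x] by simp
  qed (use * in simp)
qed

lemma exp_decay_zero [simp]: "exp_decay (\<lambda>x. 0)"
  by (rule exp_decayI[of 1 _ 0]) auto

lemma exp_decay_add:
  fixes f g :: "'a::real_normed_vector \<Rightarrow> 'b::real_normed_vector"
  assumes "exp_decay f" "exp_decay g"
  shows "exp_decay (\<lambda>x. f x + g x)"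
proof -
  obtain C c where *: "C > 0" "c > 0" "\<And>x. norm (f x) \<le> C * exp (- c * norm x)"
    using exp_decayE[OF assms(1)] by blast
  obtain D d where **: "D > 0" "d > 0" "\<And>x. norm (g x) \<le> D * exp (- d * norm x)"
    using exp_decayE[OF assms(2)] by blast
  show ?thesis
  proof (rule exp_decayI[of "min c d" _ "C + D"])
    fix x :: 'a
    have "C * exp (- c * norm x) \<le> C * exp (- min c d * norm x)"
      using * by (simp add: mult_right_mono)
    moreover have "D * exp (- d * norm x) \<le> D * exp (- min c d * norm x)"
      using ** by (simp add: mult_right_mono)
    ultimately show "norm (f x + g x) \<le> (C + D) * exp (- min c d * norm x)"
      using *(3)[of x] **(3)[of x] norm_triangle_ineq[of "f x" "g x"] by (simp add: algebra_simps)
  qed (use * ** in simp)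
qed

lemma exp_decay_sum: "(\<And>i. i \<in> I \<Longrightarrow> exp_decay (f i)) \<Longrightarrow> exp_decay (\<lambda>x. \<Sum>i\<in>I. f i x)"
  by (induction I rule: infinite_finite_induct) (auto intro: exp_decay_add)

lemma exp_decay_norm: "exp_decay f \<Longrightarrow> exp_decay (\<lambda>x. norm (f x))"
  by (erule exp_decay_mono[where B = 1]) simp

lemma exp_decay_uminus: "exp_decay f \<Longrightarrow> exp_decay (\<lambda>x. - f x)"
  by (erule exp_decay_mono[where B = 1]) simp

lemma exp_decay_diff: "exp_decay f \<Longrightarrow> exp_decay g \<Longrightarrow> exp_decay (\<lambda>x. f x - g x)"
  using exp_decay_add[OF _ exp_decay_uminus, of f g] by simp

lemma exp_decay_bounded_mult:
  fixes f g :: "'a::real_normed_vector \<Rightarrow> 'b::real_normed_algebra"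
  assumes "\<And>x. norm (g x) \<le> B" "exp_decay f"
  shows "exp_decay (\<lambda>x. g x * f x)"
  by (rule exp_decay_mono[OF assms(2), of _ B])
     (meson assms(1) mult_right_mono norm_ge_zero norm_mult_ineq order_trans)

lemma exp_decay_cmult:
  fixes f :: "'a::real_normed_vector \<Rightarrow> 'b::real_normed_algebra"
  shows "exp_decay f \<Longrightarrow> exp_decay (\<lambda>x. c * f x)"
  using exp_decay_bounded_mult[of "\<lambda>_. c" "norm c" f] by simp

lemma exp_decay_mult:
  fixes f g :: "'a::real_normed_vector \<Rightarrow> 'b::real_normed_algebra"
  assumes "exp_decay f" "exp_decay g"
  shows "exp_decay (\<lambda>x. f x * g x)"
  using exp_decay_bounded[OF assms(1)] exp_decay_bounded_mult[OF _ assms(2)] by metis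

lemma exp_decay_Re: "exp_decay f \<Longrightarrow> exp_decay (\<lambda>x. Re (f x))"
  by (erule exp_decay_mono[where B = 1]) (simp add: abs_Re_le_cmod)

lemma exp_decay_cnj: "exp_decay f \<Longrightarrow> exp_decay (\<lambda>x. cnj (f x))"
  by (erule exp_decay_mono[where B = 1]) simp

lemma exp_decay_of_real:
  fixes f :: "'a::real_normed_vector \<Rightarrow> real"
  shows "exp_decay f \<Longrightarrow> exp_decay (\<lambda>x. complex_of_real (f x))"
  by (erule exp_decay_mono[where B = 1]) simp

text \<open>Half of the exponential pays for the factor \<open>norm x\<close>, by y \<le> exp y with
  y = c/2 times the norm.\<close>

lemma norm_mult_exp_le:
  fixes x :: "'a::real_normed_vector"
  assumes "c > 0"
  shows "norm x * exp (- c * norm x) \<le> 2 / c * exp (- (c / 2) * norm x)"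
proof -
  have "c / 2 * norm x \<le> exp (c / 2 * norm x)"
    using exp_ge_add_one_self[of "c / 2 * norm x"] by linarith
  then have "norm x \<le> 2 / c * exp (c / 2 * norm x)"
    using assms by (simp add: field_simps)
  then have "norm x * exp (- c * norm x) \<le> 2 / c * exp (c / 2 * norm x) * exp (- c * norm x)"
    by (intro mult_right_mono) auto
  also have "\<dots> = 2 / c * exp (- (c / 2) * norm x)"
    by (simp flip: exp_add)
  finally show ?thesis .
qed

lemma exp_decay_norm_mult:
  assumes "exp_decay f"
  shows "exp_decay (\<lambda>x. norm x *\<^sub>R f x)"
proof -
  obtain C c where *: "C > 0" "c > 0" "\<And>x. norm (f x) \<le> C * exp (- c * norm x)"
    using exp_decayE[OF assms(1)] by blast
  show ?thesis
  proof (rule exp_decayI[of "c / 2" _ "C * (2 / c)"])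
    fix x
    have "norm x * norm (f x) \<le> norm x * (C * exp (- c * norm x))"
      using * by (intro mult_left_mono) auto
    also have "\<dots> = C * (norm x * exp (- c * norm x))" by simp
    also have "\<dots> \<le> C * (2 / c * exp (- (c / 2) * norm x))"
      using * norm_mult_exp_le[of c x] by (intro mult_left_mono) auto
    finally show "norm (norm x *\<^sub>R f x) \<le> C * (2 / c) * exp (- (c / 2) * norm x)" by simp
  qed (use * in simp)
qed

lemma exp_decay_coord:
  fixes f :: "real ^ 'n::finite \<Rightarrow> complex"
  assumes "exp_decay f"
  shows "exp_decay (\<lambda>x. complex_of_real (x $ i) * f x)"
  by (rule exp_decay_mono[OF exp_decay_norm_mult[OF assms], of _ 1])
     (simp add: norm_mult component_le_norm_cart mult_right_mono)

lemma exp_decay_coord_real: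
  fixes f :: "real ^ 'n::finite \<Rightarrow> real"
  assumes "exp_decay f"
  shows "exp_decay (\<lambda>x. x $ i * f x)"
  by (rule exp_decay_mono[OF exp_decay_norm_mult[OF assms], of _ 1])
     (simp add: abs_mult component_le_norm_cart mult_right_mono)

lemma integrable_exp_decay:
  fixes f :: "'a::euclidean_space \<Rightarrow> 'b::{banach, second_countable_topology}"
  assumes "continuous_on UNIV f" "exp_decay f"
  shows "integrable lborel f"
proof -
  obtain C c where *: "C > 0" "c > 0" "\<And>x. norm (f x) \<le> C * exp (- c * norm x)"
    using exp_decayE[OF assms(2)] by blast
  show ?thesis
    by (rule Bochner_Integration.integrable_bound[where f = "\<lambda>x. C * exp (- c * norm x)"])
       (use * integrable_exp_norm[of c] assms(1) in \<open>auto intro: borel_measurable_continuous_onI\<close>)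
qed

text \<open>Translation invariance replaces an iterated integral with boundary terms: the integral
  of \<open>f (x + t *\<^sub>R e)\<close> is constant in \<open>t\<close>, and differentiating it
  under the integral sign at 0 gives the integral of \<open>f'\<close>.\<close>

lemma integral_partial_derivative_zero:
  fixes f :: "'a::euclidean_space \<Rightarrow> real"
  assumes deriv: "\<And>x. ((\<lambda>h. f (x + h *\<^sub>R e)) has_real_derivative f' x) (at 0)"
    and cont: "continuous_on UNIV f" "continuous_on UNIV f'"
    and decay: "exp_decay f" "exp_decay f'"
  shows "(LINT x|lborel. f' x) = 0"
proof -
  obtain C c where *: "C > 0" "c > 0" "\<And>x. norm (f' x) \<le> C * exp (- c * norm x)"
    using exp_decayE[OF decay(2)] by blast
  have shift: "integrable lborel (\<lambda>x. f (x + v)) \<and> (LINT x|lborel. f (x + v)) = (LINT x|lborel. f x)" for v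
  proof -
    have f: "f \<in> borel_measurable borel" using cont(1) by (rule borel_measurable_continuous_onI)
    have m: "(+) v \<in> measurable lborel borel" by simp
    have "integrable (distr lborel borel ((+) v)) f"
      using integrable_exp_decay[OF cont(1) decay(1)] by (simp add: lborel_distr_plus)
    then have "integrable lborel (\<lambda>x. f (v + x))"
      using integrable_distr_eq[OF m f] by simp
    moreover have "(LINT x|lborel. f (v + x)) = (LINT x|lborel. f x)"
      using integral_distr[OF m f] by (simp add: lborel_distr_plus)
    ultimately show ?thesis by (simp add: add.commute)
  qed
  have "((\<lambda>t. LINT x|lborel. f (x + t *\<^sub>R e)) has_real_derivative (LINT x|lborel. f' (x + 0 *\<^sub>R e))) (at 0)"
  proof (rule has_field_derivative_integral)
    show "integrable lborel (\<lambda>x. f (x + t *\<^sub>R e))" for t using shift by blast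
    show "((\<lambda>t. f (x + t *\<^sub>R e)) has_real_derivative f' (x + t *\<^sub>R e)) (at t)" for t x
    proof -
      have "((\<lambda>h. f (x + (h + t) *\<^sub>R e)) has_real_derivative f' (x + t *\<^sub>R e)) (at 0)"
        using deriv[of "x + t *\<^sub>R e"] by (simp add: algebra_simps)
      then show ?thesis using DERIV_shift[of "\<lambda>h. f (x + h *\<^sub>R e)" _ 0 t] by simp
    qed
    show "(\<lambda>x. f' (x + 0 *\<^sub>R e)) \<in> borel_measurable lborel"
      using cont(2) by (simp add: borel_measurable_continuous_onI)
    \<comment> \<open>A translation by at most \<open>norm e\<close> changes the envelope by at most
      the factor \<open>exp (c * norm e)\<close>.\<close>
    show "\<bar>f' (x + t *\<^sub>R e)\<bar> \<le> C * exp (c * norm e) * exp (- c * norm x)" if "\<bar>t - 0\<bar> \<le> 1" for t x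
    proof -
      have "norm x \<le> norm (x + t *\<^sub>R e) + norm (t *\<^sub>R e)"
        using norm_triangle_ineq4[of "x + t *\<^sub>R e" "t *\<^sub>R e"] by simp
      also have "norm (t *\<^sub>R e) \<le> norm e" using that by (simp add: mult_left_le_one_le)
      finally have "c * norm x \<le> c * (norm (x + t *\<^sub>R e) + norm e)"
        using * by (intro mult_left_mono) auto
      then have "exp (- c * norm (x + t *\<^sub>R e)) \<le> exp (c * norm e) * exp (- c * norm x)"
        by (simp add: exp_add[symmetric] algebra_simps)
      then have "C * exp (- c * norm (x + t *\<^sub>R e)) \<le> C * (exp (c * norm e) * exp (- c * norm x))"
        using * by (intro mult_left_mono) auto
      then show ?thesis using *(3)[of "x + t *\<^sub>R e"] by (simp add: mult.assoc)
    qed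
    show "integrable lborel (\<lambda>x. C * exp (c * norm e) * exp (- c * norm x))"
      using integrable_exp_norm[OF *(2)] by (intro integrable_mult_right)
  qed
  moreover have "(\<lambda>t. LINT x|lborel. f (x + t *\<^sub>R e)) = (\<lambda>t. LINT x|lborel. f x)"
    using shift by auto
  ultimately show ?thesis
    using DERIV_unique[OF _ DERIV_const] by fastforce
qed

section \<open>Partial derivatives\<close>

lemma pd_eq: "(f has_derivative f') (at x) \<Longrightarrow> pd i f x = f' (axis i 1)"
  unfolding pd_def using frechet_derivative_at by metis

lemma has_vector_derivative_pd:
  assumes "f differentiable (at x)"
  shows "((\<lambda>h. f (x + h *\<^sub>R axis i 1)) has_vector_derivative pd i f x) (at 0)"
proof -
  obtain f' where f': "(f has_derivative f') (at x)" using assms by (auto simp: differentiable_def)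
  have "((\<lambda>h. f (x + h *\<^sub>R axis i 1)) has_derivative (\<lambda>h. f' (h *\<^sub>R axis i 1))) (at 0)"
    by (rule has_derivative_compose[of "\<lambda>h. x + h *\<^sub>R axis i 1" "\<lambda>h. h *\<^sub>R axis i 1" 0 UNIV f f'])
       (use f' in \<open>auto intro!: derivative_eq_intros\<close>)
  moreover have "f' (h *\<^sub>R axis i 1) = h *\<^sub>R pd i f x" for h
    using pd_eq[OF f', of i] has_derivative_linear[OF f'] by (simp add: linear_cmul)
  ultimately show ?thesis by (simp add: has_vector_derivative_def)
qed

lemma Ck_2D:
  assumes "Ck 2 f"
  shows "f differentiable (at x)" "pd i f differentiable (at x)"
    and "continuous_on UNIV f" "continuous_on UNIV (pd i f)" "continuous_on UNIV (pd i (pd j f))"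
    and "continuous_on UNIV (laplacian f)"
proof -
  have *: "(\<forall>x. f differentiable (at x)) \<and> (\<forall>i. (\<forall>x. pd i f differentiable (at x))
      \<and> (\<forall>j. continuous_on UNIV (pd j (pd i f))))"
    using assms by (simp add: numeral_2_eq_2)
  then show "f differentiable (at x)" "pd i f differentiable (at x)" "continuous_on UNIV (pd i (pd j f))"
    by blast+
  show "continuous_on UNIV f" "continuous_on UNIV (pd i f)"
    using * by (auto simp: continuous_on_eq_continuous_at differentiable_imp_continuous_within)
  show "continuous_on UNIV (laplacian f)"
    using * unfolding laplacian_def[abs_def] by (intro continuous_on_sum) auto
qed

section \<open>The ground state\<close>

text \<open>Compactness bounds \<open>f\<close> on the unit ball, where the envelope is at least
  \<open>exp (- c)\<close>; hence the factor \<open>exp c\<close> in \<open>D\<close>. The radial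
  formulas are singular at the origin, so estimates derived from them are used outside this ball
  only.\<close>

lemma exp_decay_outside:
  fixes f :: "'a::euclidean_space \<Rightarrow> 'b::real_normed_vector"
  assumes "continuous_on UNIV f" "c > 0"
    and bound: "\<And>x. norm x \<ge> 1 \<Longrightarrow> norm (f x) \<le> C * exp (- c * norm x)"
  shows "exp_decay f"
proof -
  have "bounded (f ` cball 0 1)"
    using assms(1) by (intro compact_imp_bounded compact_continuous_image)
      (auto intro: continuous_on_subset)
  then obtain B where B: "\<And>x. norm x \<le> 1 \<Longrightarrow> norm (f x) \<le> B"
    by (fastforce simp: bounded_iff)
  define D where "D = \<bar>C\<bar> + \<bar>B\<bar> * exp c"
  show ?thesis
  proof (rule exp_decayI[OF assms(2), of _ D])
    fix x
    show "norm (f x) \<le> D * exp (- c * norm x)"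
    proof (cases "norm x \<ge> 1")
      case True
      have "C * exp (- c * norm x) \<le> D * exp (- c * norm x)"
        by (intro mult_right_mono) (auto simp: D_def abs_le_iff intro: add_increasing2)
      with bound[OF True] show ?thesis by linarith
    next
      case False
      then have "c * norm x \<le> c * 1" using assms(2) by (intro mult_left_mono) auto
      then have "1 \<le> exp c * exp (- c * norm x)" by (simp flip: exp_add)
      then have "\<bar>B\<bar> * 1 \<le> \<bar>B\<bar> * (exp c * exp (- c * norm x))" by (intro mult_left_mono) auto
      also have "\<dots> \<le> D * exp (- c * norm x)" by (simp add: D_def algebra_simps)
      finally show ?thesis using B[of x] False by linarith
    qed
  qed
qed

lemma has_derivative_radial:
  fixes q :: "real \<Rightarrow> real" and x :: "'a::real_inner"
  assumes "(q has_real_derivative q') (at (norm x))" "x \<noteq> 0"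
  shows "((\<lambda>y. q (norm y)) has_derivative (\<lambda>h. q' * (x \<bullet> h / norm x))) (at x)"
proof -
  have "(norm has_derivative (\<lambda>h. sgn x \<bullet> h)) (at x)"
    using has_derivative_norm[OF assms(2)] by (simp add: inner_commute)
  from DERIV_compose_FDERIV[OF assms(1) this] show ?thesis
    by (simp add: sgn_div_norm inverse_eq_divide mult.commute)
qed

lemma pd_radial:
  fixes Q :: "real ^ 'n::finite \<Rightarrow> real"
  assumes "\<And>x. x \<noteq> 0 \<Longrightarrow> Q x = q (norm x)" "(q has_real_derivative q') (at (norm x))" "x \<noteq> 0"
  shows "pd i Q x = q' * (x $ i / norm x)"
proof -
  have "(Q has_derivative (\<lambda>h. q' * (x \<bullet> h / norm x))) (at x)"
    by (rule has_derivative_transform_within_open[OF has_derivative_radial[OF assms(2,3)], of "-{0}"])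
       (use assms in auto)
  then show ?thesis by (simp add: pd_eq inner_axis)
qed

text \<open>\<open>pd i Q\<close> is the radial function \<open>q1 r / r\<close> times the
  coordinate \<open>x $ i\<close>; the product rule is applied to this form.\<close>

lemma pd_pd_radial:
  fixes Q :: "real ^ 'n::finite \<Rightarrow> real"
  assumes Q: "\<And>x. Q x = q (norm x)"
    and q: "\<And>r. r > 0 \<Longrightarrow> (q has_real_derivative q1 r) (at r)"
    and q1: "\<And>r. r > 0 \<Longrightarrow> (q1 has_real_derivative q2 r) (at r)"
    and x: "x \<noteq> 0"
  defines "r \<equiv> norm x"
  shows "pd j (pd i Q) x = q2 r * (x $ i * x $ j / r\<^sup>2)
    + q1 r * ((if i = j then 1 else 0) / r - x $ i * x $ j / r ^ 3)"
proof -
  have r: "r > 0" using x by (simp add: r_def)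
  have 1: "((\<lambda>y. q1 (norm y) / norm y) has_derivative (\<lambda>h. (q2 r / r - q1 r / r\<^sup>2) * (x \<bullet> h / norm x))) (at x)"
  proof (rule has_derivative_radial)
    show "((\<lambda>r. q1 r / r) has_real_derivative q2 r / r - q1 r / r\<^sup>2) (at (norm x))"
      using q1[OF r] r by (auto intro!: derivative_eq_intros simp: r_def field_simps power2_eq_square)
  qed fact
  have 2: "((\<lambda>y. y $ i) has_derivative (\<lambda>h. h $ i)) (at x)"
    by (rule bounded_linear_imp_has_derivative[OF bounded_linear_vec_nth])
  have "(pd i Q has_derivative (\<lambda>h. q1 (norm x) / norm x * h $ i
      + (q2 r / r - q1 r / r\<^sup>2) * (x \<bullet> h / norm x) * x $ i)) (at x)"
    by (rule has_derivative_transform_within_open[OF has_derivative_mult[OF 1 2], of "-{0}"])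
       (use x pd_radial[of Q q, OF Q q] in auto)
  from pd_eq[OF this, of j] show ?thesis
    using r by (simp add: inner_axis flip: r_def) (auto simp: axis_def field_simps power2_eq_square power3_eq_cube)
qed

text \<open>The trace of the Hessian formula: the squared coordinates add up to the squared norm and
  the Kronecker deltas to the dimension.\<close>

lemma laplacian_radial:
  fixes Q :: "real ^ 'n::finite \<Rightarrow> real"
  assumes "\<And>x. Q x = q (norm x)"
    and "\<And>r. r > 0 \<Longrightarrow> (q has_real_derivative q1 r) (at r)"
    and "\<And>r. r > 0 \<Longrightarrow> (q1 has_real_derivative q2 r) (at r)"
    and x: "x \<noteq> 0"
  defines "r \<equiv> norm x"
  shows "laplacian Q x = q2 r + (real CARD('n) - 1) / r * q1 r"
proof -
  have r: "r > 0" using x by (simp add: r_def)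
  have "(\<Sum>i\<in>UNIV. (x $ i)\<^sup>2) = r\<^sup>2"
    by (simp add: r_def norm_vec_def L2_set_def sum_nonneg)
  have "pd i (pd i Q) x = (q2 r / r\<^sup>2 - q1 r / r ^ 3) * (x $ i)\<^sup>2 + q1 r / r" for i
    using r pd_pd_radial[of Q q q1 q2 x i i, OF assms(1-4)]
    by (simp add: r_def field_simps power2_eq_square power3_eq_cube)
  then have "laplacian Q x = (q2 r / r\<^sup>2 - q1 r / r ^ 3) * r\<^sup>2 + real CARD('n) * (q1 r / r)"
    by (simp add: laplacian_def sum.distrib \<open>_ = r\<^sup>2\<close> flip: sum_distrib_left)
  also have "(q2 r / r\<^sup>2 - q1 r / r ^ 3) * r\<^sup>2 = q2 r - q1 r / r"
    using r by (simp add: field_simps power2_eq_square power3_eq_cube)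
  finally show ?thesis by (simp add: diff_divide_distrib algebra_simps)
qed


text \<open>The profile \<open>q\<close> along one axis solves q'' + (m/r) q' = g with a decaying
  \<open>g\<close>. The mean value theorem finds a point just beyond \<open>r\<close> where q' is
  small; the form (s^m q')' = s^m g carries this back to \<open>r\<close>; then q'' is read off from
  the equation.\<close>

lemma ground_state_decay:
  fixes Q :: "real ^ 'n::finite \<Rightarrow> real"
  assumes gs: "ground_state p Q" and p: "p > 0"
  shows "exp_decay Q" "exp_decay (pd i Q)" "exp_decay (pd j (pd i Q))"
proof -
  have radial: "\<And>x y. norm x = norm y \<Longrightarrow> Q x = Q y" and Ck: "Ck 2 Q"
    and eq: "\<And>x. - laplacian Q x + Q x - \<bar>Q x\<bar> powr p * Q x = 0"
    using gs unfolding ground_state_def by blast+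
  obtain C \<delta> where C: "C > 0" "\<delta> > 0" and Qb: "\<And>x. \<bar>Q x\<bar> \<le> C * exp (- \<delta> * norm x)"
    using gs unfolding ground_state_def by blast
  show "exp_decay Q" by (rule exp_decayI[of \<delta> _ C]) (use C Qb in auto)
  define k :: 'n where "k = undefined"
  define e :: "real ^ 'n" where "e = axis k 1"
  define q q1 q2 where "q r = Q (r *\<^sub>R e)" and "q1 r = pd k Q (r *\<^sub>R e)"
    and "q2 r = pd k (pd k Q) (r *\<^sub>R e)" for r
  define m where "m = CARD('n) - 1"
  have m: "real CARD('n) - 1 = real m" by (simp add: m_def of_nat_diff Suc_leI)
  have e: "norm e = 1" by (simp add: e_def)
  have along: "((\<lambda>h. f (h *\<^sub>R e)) has_real_derivative pd k f (r *\<^sub>R e)) (at r)"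
    if "\<And>x. f differentiable (at x)" for f :: "real ^ 'n \<Rightarrow> real" and r
  proof -
    have "((\<lambda>h. f ((h + r) *\<^sub>R e)) has_real_derivative pd k f (r *\<^sub>R e)) (at 0)"
      using has_vector_derivative_pd[OF that, of "r *\<^sub>R e" k]
      by (simp add: has_real_derivative_iff_has_vector_derivative algebra_simps flip: e_def)
    then show ?thesis using DERIV_shift[of "\<lambda>h. f (h *\<^sub>R e)" _ 0 r] by simp
  qed
  have q: "(q has_real_derivative q1 r) (at r)" for r
    unfolding q_def[abs_def] q1_def by (intro along Ck_2D(1)[OF Ck])
  have q1: "(q1 has_real_derivative q2 r) (at r)" for r
    unfolding q1_def[abs_def] q2_def by (intro along Ck_2D(2)[OF Ck])
  have Qq: "Q x = q (norm x)" for x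
    unfolding q_def by (rule radial) (simp add: e)
  define g where "g r = q r - \<bar>q r\<bar> powr p * q r" for r
  have ode: "q2 r + real m / r * q1 r = g r" if "r > 0" for r
  proof -
    have "r *\<^sub>R e \<noteq> 0" using e that by auto
    from laplacian_radial[of Q q q1 q2, OF Qq q q1 this]
    have "laplacian Q (r *\<^sub>R e) = q2 r + real m / r * q1 r"
      using that by (simp add: e m)
    with eq[of "r *\<^sub>R e"] show ?thesis by (simp add: g_def q_def)
  qed
  \<comment> \<open>\<open>D\<close> bounds \<open>g\<close>: one \<open>C\<close> for the linear
    term, \<open>C powr p * C\<close> for the power term.\<close>
  define D where "D = C + C powr p * C"
  have D: "D \<ge> 0" using C by (simp add: D_def)
  have qb: "\<bar>q r\<bar> \<le> C * exp (- \<delta> * r)" if "r > 0" for r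
    using Qb[of "r *\<^sub>R e"] that by (simp add: e q_def)
  have gb: "\<bar>g r\<bar> \<le> D * exp (- \<delta> * r)" if "r > 0" for r
  proof -
    have "C * exp (- \<delta> * r) \<le> C * 1"
      using that C by (intro mult_left_mono) auto
    then have "\<bar>q r\<bar> \<le> C" using qb[OF that] by simp
    then have "\<bar>q r\<bar> powr p * \<bar>q r\<bar> \<le> C powr p * (C * exp (- \<delta> * r))"
      using qb[OF that] C p by (intro mult_mono powr_mono2) auto
    moreover have "\<bar>g r\<bar> \<le> \<bar>q r\<bar> + \<bar>q r\<bar> powr p * \<bar>q r\<bar>"
      unfolding g_def by (rule order_trans[OF abs_triangle_ineq4]) (simp add: abs_mult)
    ultimately show ?thesis using qb[OF that] by (simp add: D_def algebra_simps)
  qed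
  \<comment> \<open>\<open>2 * C\<close> comes from the increment of \<open>q\<close> over
    [r, r + 1], \<open>D\<close> from \<open>g\<close> on that interval, and \<open>2 ^ m\<close>
    from (r + 1)^m \<le> (2r)^m, valid for r \<ge> 1.\<close>
  define K where "K = 2 ^ m * (2 * C + D)"
  have K: "K \<ge> 0" using C D by (simp add: K_def)
  have q1b: "\<bar>q1 r\<bar> \<le> K * exp (- \<delta> * r)" if r: "r \<ge> 1" for r
  proof -
    have dec: "exp (- \<delta> * s) \<le> exp (- \<delta> * r)" if "r \<le> s" for s
      using that C by simp
    obtain \<xi> where \<xi>: "r < \<xi>" "\<xi> < r + 1" "q (r + 1) - q r = (r + 1 - r) * q1 \<xi>"
      using MVT2[of r "r + 1" q q1] q by auto
    have "C * exp (- \<delta> * (r + 1)) \<le> C * exp (- \<delta> * r)"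
      using C dec[of "r + 1"] by (intro mult_left_mono) auto
    then have \<xi>b: "\<bar>q1 \<xi>\<bar> \<le> 2 * C * exp (- \<delta> * r)"
      using \<xi>(3) qb[of r] qb[of "r + 1"] r by (simp add: abs_le_iff)
    have "((\<lambda>s. s ^ m * q1 s) has_real_derivative s ^ m * g s) (at s)" if "r \<le> s" for s
    proof -
      have s: "s > 0" using that r by simp
      \<comment> \<open>In dimension one \<open>m\<close> is 0 and \<open>m - 1\<close> is
        truncated; both sides then vanish, hence the case split.\<close>
      have "real m * s ^ (m - 1) = s ^ m * (real m / s)"
        using s by (cases m) auto
      then have "real m * s ^ (m - 1) * q1 s + s ^ m * q2 s = s ^ m * g s"
        by (simp add: algebra_simps flip: ode[OF s])
      then show ?thesis
        by (auto intro!: derivative_eq_intros q1 simp: algebra_simps)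
    qed
    then obtain \<eta> where \<eta>: "r < \<eta>" "\<eta> < \<xi>" "\<xi> ^ m * q1 \<xi> - r ^ m * q1 r = (\<xi> - r) * (\<eta> ^ m * g \<eta>)"
      using MVT2[of r \<xi> "\<lambda>s. s ^ m * q1 s" "\<lambda>s. s ^ m * g s"] \<xi> by auto
    have "\<bar>g \<eta>\<bar> \<le> D * exp (- \<delta> * r)"
      using gb[of \<eta>] \<eta> r dec[of \<eta>] D by (smt (verit) mult_left_mono)
    then have 1: "(\<xi> - r) * (\<eta> ^ m * \<bar>g \<eta>\<bar>) \<le> 1 * ((r + 1) ^ m * (D * exp (- \<delta> * r)))"
      using \<xi> \<eta> r D by (intro mult_mono power_mono) auto
    have 2: "\<xi> ^ m * \<bar>q1 \<xi>\<bar> \<le> (r + 1) ^ m * (2 * C * exp (- \<delta> * r))"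
      using \<xi> \<xi>b r by (intro mult_mono power_mono) auto
    have "r ^ m * q1 r = \<xi> ^ m * q1 \<xi> - (\<xi> - r) * (\<eta> ^ m * g \<eta>)"
      using \<eta>(3) by simp
    then have "\<bar>r ^ m * q1 r\<bar> \<le> \<bar>\<xi> ^ m * q1 \<xi>\<bar> + \<bar>(\<xi> - r) * (\<eta> ^ m * g \<eta>)\<bar>"
      by (simp only: abs_triangle_ineq4)
    then have "r ^ m * \<bar>q1 r\<bar> \<le> \<xi> ^ m * \<bar>q1 \<xi>\<bar> + (\<xi> - r) * (\<eta> ^ m * \<bar>g \<eta>\<bar>)"
      using r \<xi> \<eta> by (simp add: abs_mult)
    also have "\<dots> \<le> (r + 1) ^ m * ((2 * C + D) * exp (- \<delta> * r))"
      using 1 2 by (simp add: algebra_simps)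
    also have "\<dots> \<le> (2 * r) ^ m * ((2 * C + D) * exp (- \<delta> * r))"
      using r C D by (intro mult_right_mono power_mono) auto
    finally have "r ^ m * \<bar>q1 r\<bar> \<le> r ^ m * (K * exp (- \<delta> * r))"
      by (simp add: K_def power_mult_distrib algebra_simps)
    then show ?thesis using r by (simp add: mult_le_cancel_left)
  qed
  have q2b: "\<bar>q2 r\<bar> \<le> (D + real m * K) * exp (- \<delta> * r)" if r: "r \<ge> 1" for r
  proof -
    have "real m / r * \<bar>q1 r\<bar> \<le> real m * (K * exp (- \<delta> * r))"
      using r q1b[OF r] by (intro mult_mono) (auto simp: divide_le_eq mult_le_cancel_left1)
    moreover have "q2 r = g r - real m / r * q1 r" using ode[of r] r by simp
    then have "\<bar>q2 r\<bar> \<le> \<bar>g r\<bar> + \<bar>real m / r * q1 r\<bar>" by (simp only: abs_triangle_ineq4)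
    ultimately show ?thesis using gb[of r] r by (simp add: abs_mult algebra_simps)
  qed
  have frac: "\<bar>x $ i / norm x\<bar> \<le> 1" for i and x :: "real ^ 'n"
    using component_le_norm_cart[of x i] by (simp add: divide_le_eq)
  show "exp_decay (pd i Q)"
  proof (rule exp_decay_outside[OF Ck_2D(4)[OF Ck] C(2)])
    fix x :: "real ^ 'n" assume x: "1 \<le> norm x"
    have "pd i Q x = q1 (norm x) * (x $ i / norm x)"
      by (rule pd_radial[of Q q]) (use Qq q x in auto)
    then have "\<bar>pd i Q x\<bar> \<le> \<bar>q1 (norm x)\<bar>"
      unfolding \<open>pd i Q x = _\<close> abs_mult by (intro mult_left_le frac) auto
    with q1b[OF x] show "norm (pd i Q x) \<le> K * exp (- \<delta> * norm x)" by simp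
  qed
  show "exp_decay (pd j (pd i Q))"
  proof (rule exp_decay_outside[OF Ck_2D(5)[OF Ck] C(2)])
    fix x :: "real ^ 'n" assume x: "1 \<le> norm x"
    let ?r = "norm x" and ?a = "x $ i / norm x" and ?b = "x $ j / norm x"
    have ab: "\<bar>?a * ?b\<bar> \<le> 1"
      unfolding abs_mult using frac[of x i] frac[of x j] by (intro mult_le_one) auto
    have "pd j (pd i Q) x = q2 ?r * (x $ i * x $ j / ?r\<^sup>2)
        + q1 ?r * ((if i = j then 1 else 0) / ?r - x $ i * x $ j / ?r ^ 3)"
      by (rule pd_pd_radial[of Q q]) (use Qq q q1 x in auto)
    \<comment> \<open>Grouped so that only the direction cosines \<open>?a\<close> and
      \<open>?b\<close>, bounded by 1, and a single factor 1/r remain.\<close>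
    also have "\<dots> = q2 ?r * (?a * ?b) + q1 ?r * (((if i = j then 1 else 0) - ?a * ?b) / ?r)"
      by (simp add: diff_divide_distrib power2_eq_square power3_eq_cube)
    finally have *: "pd j (pd i Q) x = q2 ?r * (?a * ?b) + q1 ?r * (((if i = j then 1 else 0) - ?a * ?b) / ?r)" .
    have "\<bar>(if i = j then 1 else 0) - w\<bar> \<le> 2" if "\<bar>w\<bar> \<le> 1" for w :: real
      using that by auto
    from this[OF ab] have "\<bar>(if i = j then 1 else 0) - ?a * ?b\<bar> \<le> 2" .
    then have "\<bar>((if i = j then 1 else 0) - ?a * ?b) / ?r\<bar> \<le> 2"
      using x by (simp add: divide_le_eq abs_divide)
    then have "\<bar>q1 ?r\<bar> * \<bar>((if i = j then 1 else 0) - ?a * ?b) / ?r\<bar> \<le> \<bar>q1 ?r\<bar> * 2"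
      by (intro mult_left_mono) auto
    moreover have "\<bar>q2 ?r\<bar> * \<bar>?a * ?b\<bar> \<le> \<bar>q2 ?r\<bar> * 1" using ab by (intro mult_left_mono) auto
    ultimately have "\<bar>pd j (pd i Q) x\<bar> \<le> \<bar>q2 ?r\<bar> + \<bar>q1 ?r\<bar> * 2"
      unfolding * by (intro order_trans[OF abs_triangle_ineq] add_mono) (simp_all only: abs_mult mult_1_right)
    with q1b[OF x] q2b[OF x]
    show "norm (pd j (pd i Q) x) \<le> ((D + real m * K) + 2 * K) * exp (- \<delta> * norm x)"
      by (simp add: algebra_simps)
  qed
qed

section \<open>Symmetry of second derivatives\<close>

lemma pd_bounded_linear:
  assumes "bounded_linear L" "f differentiable (at x)"
  shows "pd i (\<lambda>x. L (f x)) x = L (pd i f x)" "(\<lambda>x. L (f x)) differentiable (at x)"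
proof -
  obtain f' where f': "(f has_derivative f') (at x)" using assms by (auto simp: differentiable_def)
  then have "((\<lambda>x. L (f x)) has_derivative (\<lambda>h. L (f' h))) (at x)"
    by (rule bounded_linear.has_derivative[OF assms(1)])
  then show "pd i (\<lambda>x. L (f x)) x = L (pd i f x)" "(\<lambda>x. L (f x)) differentiable (at x)"
    using pd_eq f' by (metis, auto simp: differentiable_def)
qed

lemma Ck_bounded_linear:
  assumes "bounded_linear L"
  shows "Ck k f \<Longrightarrow> Ck k (\<lambda>x. L (f x))"
proof (induction k arbitrary: f)
  case 0
  then show ?case
    using bounded_linear.continuous_on[OF assms] by auto
next
  case (Suc k)
  then have "pd i (\<lambda>x. L (f x)) = (\<lambda>x. L (pd i f x))" for i
    using pd_bounded_linear[OF assms] by fastforce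
  then show ?case using Suc pd_bounded_linear(2)[OF assms] by fastforce
qed

text \<open>The mean value theorem twice: in direction \<open>i\<close> for the increment of
  \<open>f\<close> in direction \<open>j\<close>, then in direction \<open>j\<close> for
  \<open>pd i f\<close>. The left-hand side is symmetric in \<open>i\<close> and \<open>j\<close>,
  the right-hand side is not visibly so; that asymmetry yields Schwarz's theorem.\<close>

lemma second_difference:
  fixes f :: "real ^ 'n::finite \<Rightarrow> real"
  assumes "Ck 2 f" "h > 0"
  obtains y where "dist y x \<le> 2 * h"
    "f (x + h *\<^sub>R axis i 1 + h *\<^sub>R axis j 1) - f (x + h *\<^sub>R axis i 1) - f (x + h *\<^sub>R axis j 1) + f x
      = h\<^sup>2 * pd j (pd i f) y"
proof -
  have along: "((\<lambda>t. g (z + t *\<^sub>R axis k 1)) has_real_derivative pd k g (z + t *\<^sub>R axis k 1)) (at t)"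
    if "\<And>x. g differentiable (at x)" for g :: "real ^ 'n \<Rightarrow> real" and k z t
  proof -
    have "((\<lambda>h. g (z + (h + t) *\<^sub>R axis k 1)) has_real_derivative pd k g (z + t *\<^sub>R axis k 1)) (at 0)"
      using has_vector_derivative_pd[OF that, of "z + t *\<^sub>R axis k 1" k]
      by (simp add: has_real_derivative_iff_has_vector_derivative algebra_simps)
    then show ?thesis using DERIV_shift[of "\<lambda>h. g (z + h *\<^sub>R axis k 1)" _ 0 t] by simp
  qed
  let ?G = "\<lambda>s. f (x + h *\<^sub>R axis j 1 + s *\<^sub>R axis i 1) - f (x + s *\<^sub>R axis i 1)"
  have G: "(?G has_real_derivative pd i f (x + h *\<^sub>R axis j 1 + s *\<^sub>R axis i 1) - pd i f (x + s *\<^sub>R axis i 1)) (at s)" for s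
    by (intro DERIV_diff along Ck_2D(1)[OF assms(1)])
  from MVT2[OF assms(2) G] obtain s where s: "0 < s" "s < h" "?G h - ?G 0
      = (h - 0) * (pd i f (x + h *\<^sub>R axis j 1 + s *\<^sub>R axis i 1) - pd i f (x + s *\<^sub>R axis i 1))"
    by blast
  have "((\<lambda>t. pd i f (x + s *\<^sub>R axis i 1 + t *\<^sub>R axis j 1)) has_real_derivative
      pd j (pd i f) (x + s *\<^sub>R axis i 1 + t *\<^sub>R axis j 1)) (at t)" for t
    by (intro along Ck_2D(2)[OF assms(1)])
  from MVT2[OF assms(2) this] obtain t where t: "0 < t" "t < h"
    "pd i f (x + s *\<^sub>R axis i 1 + h *\<^sub>R axis j 1) - pd i f (x + s *\<^sub>R axis i 1 + 0 *\<^sub>R axis j 1)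
      = (h - 0) * pd j (pd i f) (x + s *\<^sub>R axis i 1 + t *\<^sub>R axis j 1)"
    by blast
  show ?thesis
  proof (rule that)
    have "norm (s *\<^sub>R axis i (1::real) + t *\<^sub>R axis j 1) \<le> h + h"
      by (intro norm_triangle_le add_mono) (use s t in auto)
    then show "dist (x + s *\<^sub>R axis i 1 + t *\<^sub>R axis j 1) x \<le> 2 * h"
      by (simp add: dist_norm add.assoc)
    have eq: "x + h *\<^sub>R axis j 1 + s *\<^sub>R axis i 1 = x + s *\<^sub>R axis i 1 + h *\<^sub>R axis j 1" for s
      by (simp add: algebra_simps)
    show "f (x + h *\<^sub>R axis i 1 + h *\<^sub>R axis j 1) - f (x + h *\<^sub>R axis i 1) - f (x + h *\<^sub>R axis j 1) + f x
      = h\<^sup>2 * pd j (pd i f) (x + s *\<^sub>R axis i 1 + t *\<^sub>R axis j 1)"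
      using s(3) t(3) unfolding eq by (simp add: power2_eq_square)
  qed
qed

text \<open>Both mixed derivatives equal the same second difference quotient at points within
  \<open>2 * h\<close> of \<open>x\<close>. With \<epsilon> half of the supposed gap, continuity at
  \<open>x\<close> contradicts this.\<close>

lemma pd_commute_real:
  fixes f :: "real ^ 'n::finite \<Rightarrow> real"
  assumes "Ck 2 f"
  shows "pd i (pd j f) x = pd j (pd i f) x"
proof (rule ccontr)
  define \<epsilon> where "\<epsilon> = \<bar>pd i (pd j f) x - pd j (pd i f) x\<bar> / 2"
  assume "\<not> ?thesis"
  then have \<epsilon>: "\<epsilon> > 0" by (simp add: \<epsilon>_def)
  have "\<exists>d>0. \<forall>y. dist y x < d \<longrightarrow> dist (pd i (pd j f) y) (pd i (pd j f) x) < \<epsilon>" for i j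
    using Ck_2D(5)[OF assms, of i j] \<epsilon> by (auto simp: continuous_on_iff)
  then obtain d1 d2 where d: "d1 > 0" "d2 > 0"
    "\<And>y. dist y x < d1 \<Longrightarrow> \<bar>pd i (pd j f) y - pd i (pd j f) x\<bar> < \<epsilon>"
    "\<And>y. dist y x < d2 \<Longrightarrow> \<bar>pd j (pd i f) y - pd j (pd i f) x\<bar> < \<epsilon>"
    unfolding dist_real_def by meson
  define h where "h = min d1 d2 / 4"
  have h: "h > 0" "2 * h < d1" "2 * h < d2" using d by (auto simp: h_def)
  obtain y where y: "dist y x \<le> 2 * h"
    "f (x + h *\<^sub>R axis i 1 + h *\<^sub>R axis j 1) - f (x + h *\<^sub>R axis i 1) - f (x + h *\<^sub>R axis j 1) + f x
      = h\<^sup>2 * pd j (pd i f) y"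
    by (rule second_difference[OF assms h(1)])
  obtain y' where y': "dist y' x \<le> 2 * h"
    "f (x + h *\<^sub>R axis j 1 + h *\<^sub>R axis i 1) - f (x + h *\<^sub>R axis j 1) - f (x + h *\<^sub>R axis i 1) + f x
      = h\<^sup>2 * pd i (pd j f) y'"
    by (rule second_difference[OF assms h(1)])
  have "h\<^sup>2 * pd i (pd j f) y' = h\<^sup>2 * pd j (pd i f) y"
  proof -
    have eq: "x + h *\<^sub>R axis j 1 + h *\<^sub>R axis i 1 = x + h *\<^sub>R axis i 1 + h *\<^sub>R axis j 1" by simp
    show ?thesis using y(2) y'(2)[unfolded eq] by linarith
  qed
  then have "pd i (pd j f) y' = pd j (pd i f) y" using h by simp
  moreover have "\<bar>pd j (pd i f) y - pd j (pd i f) x\<bar> < \<epsilon>" "\<bar>pd i (pd j f) y' - pd i (pd j f) x\<bar> < \<epsilon>"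
    using d(3)[of y'] d(4)[of y] y(1) y'(1) h by linarith+
  ultimately show False by (simp add: \<epsilon>_def abs_if split: if_splits)
qed

lemma pd_commute:
  fixes f :: "real ^ 'n::finite \<Rightarrow> complex"
  assumes "Ck 2 f"
  shows "pd i (pd j f) x = pd j (pd i f) x"
proof -
  have "L (pd i (pd j f) x) = L (pd j (pd i f) x)" if L: "bounded_linear L" for L :: "complex \<Rightarrow> real"
  proof -
    have 1: "pd k (\<lambda>x. L (f x)) = (\<lambda>x. L (pd k f x))" for k
      using pd_bounded_linear(1)[OF L Ck_2D(1)[OF assms]] by blast
    have 2: "pd l (\<lambda>x. L (pd k f x)) x = L (pd l (pd k f) x)" for k l
      using pd_bounded_linear(1)[OF L Ck_2D(2)[OF assms]] by blast
    show ?thesis using pd_commute_real[OF Ck_bounded_linear[OF L assms], of i j x] by (simp add: 1 2)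
  qed
  from this[OF bounded_linear_Re] this[OF bounded_linear_Im] show ?thesis
    by (simp add: complex_eq_iff)
qed

section \<open>Integral identities\<close>

text \<open>A relation rather than an equation about \<open>pd\<close>, so that derivatives of
  composite integrands are assembled by introduction rules; only differentiability along one axis is
  involved.\<close>

definition has_pd :: "'n::finite \<Rightarrow> (real ^ 'n \<Rightarrow> complex) \<Rightarrow> (real ^ 'n \<Rightarrow> complex) \<Rightarrow> bool" where
  "has_pd i f f' \<longleftrightarrow> (\<forall>x. ((\<lambda>h. f (x + h *\<^sub>R axis i 1)) has_vector_derivative f' x) (at 0))"

lemma has_pd_pd: "(\<And>x. f differentiable (at x)) \<Longrightarrow> has_pd i f (pd i f)"
  unfolding has_pd_def using has_vector_derivative_pd by blast

lemma has_pd_add: "has_pd i f f' \<Longrightarrow> has_pd i g g' \<Longrightarrow> has_pd i (\<lambda>x. f x + g x) (\<lambda>x. f' x + g' x)"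
  unfolding has_pd_def by (auto intro: has_vector_derivative_add)

lemma has_pd_diff: "has_pd i f f' \<Longrightarrow> has_pd i g g' \<Longrightarrow> has_pd i (\<lambda>x. f x - g x) (\<lambda>x. f' x - g' x)"
  unfolding has_pd_def by (auto intro: has_vector_derivative_diff)

lemma has_pd_sum:
  "(\<And>k. k \<in> I \<Longrightarrow> has_pd i (f k) (f' k)) \<Longrightarrow> has_pd i (\<lambda>x. \<Sum>k\<in>I. f k x) (\<lambda>x. \<Sum>k\<in>I. f' k x)"
  unfolding has_pd_def by (auto intro: has_vector_derivative_sum)

lemma has_pd_mult:
  assumes "has_pd i f f'" "has_pd i g g'"
  shows "has_pd i (\<lambda>x. f x * g x) (\<lambda>x. f x * g' x + f' x * g x)"
  unfolding has_pd_def
proof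
  fix x
  show "((\<lambda>h. f (x + h *\<^sub>R axis i 1) * g (x + h *\<^sub>R axis i 1)) has_vector_derivative
      f x * g' x + f' x * g x) (at 0)"
    using has_vector_derivative_mult[OF assms(1)[unfolded has_pd_def, rule_format, of x]
        assms(2)[unfolded has_pd_def, rule_format, of x]] by simp
qed

lemma has_pd_cnj: "has_pd i f f' \<Longrightarrow> has_pd i (\<lambda>x. cnj (f x)) (\<lambda>x. cnj (f' x))"
  unfolding has_pd_def by (auto intro: has_vector_derivative_cnj)

lemma has_pd_coord:
  fixes i k :: "'n::finite"
  shows "has_pd i (\<lambda>x. complex_of_real (x $ k)) (\<lambda>x. if k = i then 1 else 0)"
  unfolding has_pd_def
proof
  fix x :: "real ^ 'n"
  have "((\<lambda>h. complex_of_real (x $ k + h * (if k = i then 1 else 0))) has_vector_derivative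
      of_real (if k = i then 1 else 0)) (at 0)"
    by (auto intro!: derivative_eq_intros)
  then show "((\<lambda>h. complex_of_real ((x + h *\<^sub>R axis i 1) $ k)) has_vector_derivative
      (if k = i then 1 else 0)) (at 0)"
    by (simp add: axis_def if_distrib cong: if_cong)
qed

text \<open>The constant \<open>c\<close> selects the part of the complex identity that is wanted: 1
  for the real part, \<open>- \<i>\<close> for the imaginary part.\<close>

lemma integral_pd_zero:
  fixes f :: "real ^ 'n::finite \<Rightarrow> complex"
  assumes "has_pd i f f'" "continuous_on UNIV f" "continuous_on UNIV f'" "exp_decay f" "exp_decay f'"
  shows "(LINT x|lborel. Re (c * f' x)) = 0"
proof (rule integral_partial_derivative_zero)
  show "((\<lambda>h. Re (c * f (x + h *\<^sub>R axis i 1))) has_real_derivative Re (c * f' x)) (at 0)" for x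
  proof -
    have "((\<lambda>h. c * f (x + h *\<^sub>R axis i 1)) has_vector_derivative c * f' x) (at 0)"
      using assms(1) unfolding has_pd_def by (auto intro: has_vector_derivative_mult_right)
    from bounded_linear.has_vector_derivative[OF bounded_linear_Re this] show ?thesis
      by (simp add: has_real_derivative_iff_has_vector_derivative)
  qed
qed (intro continuous_intros exp_decay_Re exp_decay_cmult assms)+

definition decaying_C2 :: "(real ^ 'n::finite \<Rightarrow> complex) \<Rightarrow> bool" where
  "decaying_C2 f \<longleftrightarrow> Ck 2 f \<and> exp_decay f \<and> (\<forall>i. exp_decay (pd i f)) \<and> (\<forall>i j. exp_decay (pd j (pd i f)))"

text \<open>The Euler operator x . grad, the generator of dilations; it is not normalised by
  \<open>norm x\<close>.\<close>

definition radial_deriv :: "(real ^ 'n::finite \<Rightarrow> complex) \<Rightarrow> real ^ 'n \<Rightarrow> complex" where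
  "radial_deriv f x = (\<Sum>j\<in>UNIV. of_real (x $ j) * pd j f x)"

lemma decaying_C2D:
  assumes "decaying_C2 f"
  shows "continuous_on UNIV f" "continuous_on UNIV (pd i f)" "continuous_on UNIV (pd j (pd i f))"
    "continuous_on UNIV (laplacian f)" "continuous_on UNIV (radial_deriv f)"
    "exp_decay f" "exp_decay (pd i f)" "exp_decay (pd j (pd i f))" "exp_decay (laplacian f)"
    "exp_decay (radial_deriv f)"
    "has_pd i f (pd i f)" "has_pd j (pd i f) (pd j (pd i f))"
proof -
  have C: "Ck 2 f" and D: "exp_decay f" "\<And>i. exp_decay (pd i f)" "\<And>i j. exp_decay (pd j (pd i f))"
    using assms by (auto simp: decaying_C2_def)
  show "continuous_on UNIV f" "continuous_on UNIV (pd i f)" "continuous_on UNIV (pd j (pd i f))"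
    "continuous_on UNIV (laplacian f)" "continuous_on UNIV (radial_deriv f)"
    unfolding radial_deriv_def[abs_def] by (intro Ck_2D[OF C] continuous_intros)+
  show "exp_decay f" "exp_decay (pd i f)" "exp_decay (pd j (pd i f))" by fact+
  show "exp_decay (laplacian f)" unfolding laplacian_def[abs_def] by (intro exp_decay_sum D)
  show "exp_decay (radial_deriv f)"
    unfolding radial_deriv_def[abs_def] by (intro exp_decay_sum exp_decay_coord D)
  show "has_pd i f (pd i f)" "has_pd j (pd i f) (pd j (pd i f))"
    by (intro has_pd_pd Ck_2D[OF C])+
qed

lemma Re_of_real_mult: "Re (of_real r * z) = r * Re z"
  by simp

lemma integral_sum_zero:
  fixes f :: "'i \<Rightarrow> 'a \<Rightarrow> real"
  assumes "\<And>j. j \<in> I \<Longrightarrow> integrable M (f j)" "\<And>j. j \<in> I \<Longrightarrow> integral\<^sup>L M (f j) = 0"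
    and "\<And>x. g x = (\<Sum>j\<in>I. f j x)"
  shows "integral\<^sup>L M g = 0"
proof -
  have "g = (\<lambda>x. \<Sum>j\<in>I. f j x)" using assms(3) by auto
  then show ?thesis using assms(1,2) by (simp add: Bochner_Integration.integral_sum)
qed

text \<open>Each summand \<open>?F j\<close> is the \<open>j\<close>-th derivative of
  \<open>cnj (pd j f x) * g x\<close>, so the integrand is a divergence.\<close>

lemma Green:
  assumes f: "decaying_C2 f" and g: "decaying_C2 g"
  shows "(LINT x|lborel. Re (c * (cnj (laplacian f x) * g x + (\<Sum>j\<in>UNIV. cnj (pd j f x) * pd j g x)))) = 0"
proof (rule integral_sum_zero)
  let ?F = "\<lambda>j x. cnj (pd j f x) * pd j g x + cnj (pd j (pd j f) x) * g x"
  note D = decaying_C2D[OF f] decaying_C2D[OF g]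
  have cont: "continuous_on UNIV (?F j)" for j by (intro continuous_intros D)
  have dec: "exp_decay (?F j)" for j by (intro exp_decay_add exp_decay_mult exp_decay_cnj D)
  show "integrable lborel (\<lambda>x. Re (c * ?F j x))" for j
    by (rule integrable_exp_decay) (intro continuous_intros cont exp_decay_Re exp_decay_cmult dec)+
  show "(LINT x|lborel. Re (c * ?F j x)) = 0" for j
  proof (rule integral_pd_zero[OF _ _ cont _ dec])
    show "has_pd j (\<lambda>x. cnj (pd j f x) * g x) (?F j)"
      by (intro has_pd_mult has_pd_cnj D)
    show "continuous_on UNIV (\<lambda>x. cnj (pd j f x) * g x)" by (intro continuous_intros D)
    show "exp_decay (\<lambda>x. cnj (pd j f x) * g x)" by (intro exp_decay_mult exp_decay_cnj D)
  qed
  show "Re (c * (cnj (laplacian f x) * g x + (\<Sum>j\<in>UNIV. cnj (pd j f x) * pd j g x)))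
      = (\<Sum>j\<in>UNIV. Re (c * ?F j x))" for x
    unfolding laplacian_def
    by (simp only: Re_sum[symmetric] sum_distrib_left[symmetric] sum.distrib sum_distrib_right cnj_sum add.commute)
qed

text \<open>The integrand is the divergence of the vector field x times
  \<open>cnj (f x) * g x\<close>; the dimension appears as the divergence of x.\<close>

lemma integral_radial_deriv:
  fixes f g :: "real ^ 'n::finite \<Rightarrow> complex"
  assumes f: "decaying_C2 f" and g: "decaying_C2 g"
  shows "(LINT x|lborel. Re (c * (cnj (f x) * radial_deriv g x + cnj (radial_deriv f x) * g x
    + of_nat CARD('n) * cnj (f x) * g x))) = 0"
proof (rule integral_sum_zero)
  let ?F = "\<lambda>j x. of_real (x $ j) * (cnj (f x) * pd j g x + cnj (pd j f x) * g x) + 1 * (cnj (f x) * g x)"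
  note D = decaying_C2D[OF f] decaying_C2D[OF g]
  have cont: "continuous_on UNIV (?F j)" for j by (intro continuous_intros D)
  have dec: "exp_decay (?F j)" for j
    by (intro exp_decay_add exp_decay_mult[of f g] exp_decay_coord exp_decay_mult exp_decay_cnj exp_decay_cmult D)
  show "integrable lborel (\<lambda>x. Re (c * ?F j x))" for j
    by (rule integrable_exp_decay) (intro continuous_intros cont exp_decay_Re exp_decay_cmult dec)+
  show "(LINT x|lborel. Re (c * ?F j x)) = 0" for j
  proof (rule integral_pd_zero[OF _ _ cont _ dec])
    have "has_pd j (\<lambda>x. of_real (x $ j) * (cnj (f x) * g x))
      (\<lambda>x. of_real (x $ j) * (cnj (f x) * pd j g x + cnj (pd j f x) * g x) + (if j = j then 1 else 0) * (cnj (f x) * g x))"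
      by (intro has_pd_mult has_pd_cnj has_pd_coord D)
    then show "has_pd j (\<lambda>x. of_real (x $ j) * (cnj (f x) * g x)) (?F j)" by simp
    show "continuous_on UNIV (\<lambda>x. of_real (x $ j) * (cnj (f x) * g x))" by (intro continuous_intros D)
    show "exp_decay (\<lambda>x. of_real (x $ j) * (cnj (f x) * g x))"
      by (intro exp_decay_mult exp_decay_coord exp_decay_cnj D)
  qed
  show "Re (c * (cnj (f x) * radial_deriv g x + cnj (radial_deriv f x) * g x
    + of_nat CARD('n) * cnj (f x) * g x)) = (\<Sum>j\<in>UNIV. Re (c * ?F j x))" for x
  proof -
    have "cnj (f x) * radial_deriv g x + cnj (radial_deriv f x) * g x + of_nat CARD('n) * cnj (f x) * g x
      = (\<Sum>j\<in>UNIV. ?F j x)"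
      by (simp add: radial_deriv_def sum.distrib sum_distrib_left sum_distrib_right algebra_simps)
    then show ?thesis by (simp only: Re_sum[symmetric] sum_distrib_left[symmetric])
  qed
qed

text \<open>The integrand is the real part of the divergence of \<open>?G\<close>, the
  Rellich-Pohozaev field 2 cnj(grad f) (x . grad f) - x |grad f|^2.\<close>

lemma Pohozaev:
  fixes f :: "real ^ 'n::finite \<Rightarrow> complex"
  assumes f: "decaying_C2 f"
  shows "(LINT x|lborel. 2 * Re (cnj (laplacian f x) * radial_deriv f x)
    - (real CARD('n) - 2) * (\<Sum>j\<in>UNIV. (norm (pd j f x))\<^sup>2)) = 0"
proof (rule integral_sum_zero)
  note D = decaying_C2D[OF f]
  let ?R' = "\<lambda>j x. \<Sum>k\<in>UNIV. of_real (x $ k) * pd j (pd k f) x + (if k = j then 1 else 0) * pd k f x"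
  let ?S = "\<lambda>x. \<Sum>k\<in>UNIV. cnj (pd k f x) * pd k f x"
  let ?S' = "\<lambda>j x. \<Sum>k\<in>UNIV. cnj (pd k f x) * pd j (pd k f) x + cnj (pd j (pd k f) x) * pd k f x"
  let ?G = "\<lambda>j x. 2 * (cnj (pd j f x) * radial_deriv f x) - of_real (x $ j) * ?S x"
  let ?F = "\<lambda>j x. 2 * (cnj (pd j f x) * ?R' j x + cnj (pd j (pd j f) x) * radial_deriv f x)
    - (of_real (x $ j) * ?S' j x + ?S x)"
  have contif: "continuous_on UNIV (\<lambda>x. (if b then 1 else 0) * pd k f x)" for b k
    by (intro continuous_intros D)
  have cont: "continuous_on UNIV (?F j)" for j by (intro continuous_intros contif D)
  have dec: "exp_decay (?F j)" for j
    by (intro exp_decay_add exp_decay_diff exp_decay_sum exp_decay_coord exp_decay_cmult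
        exp_decay_mult[OF exp_decay_cnj] D)
  have pd: "has_pd j (?G j) (?F j)" for j
  proof -
    have 1: "has_pd j (radial_deriv f) (?R' j)"
      unfolding radial_deriv_def[abs_def] by (intro has_pd_sum has_pd_mult has_pd_coord D)
    have 2: "has_pd j ?S (?S' j)" by (intro has_pd_sum has_pd_mult has_pd_cnj D)
    have "has_pd j (\<lambda>x. (cnj (pd j f x) * radial_deriv f x + cnj (pd j f x) * radial_deriv f x) - of_real (x $ j) * ?S x)
      (\<lambda>x. ((cnj (pd j f x) * ?R' j x + cnj (pd j (pd j f) x) * radial_deriv f x)
        + (cnj (pd j f x) * ?R' j x + cnj (pd j (pd j f) x) * radial_deriv f x))
        - (of_real (x $ j) * ?S' j x + (if j = j then 1 else 0) * ?S x))"
      by (intro has_pd_diff has_pd_add has_pd_mult has_pd_cnj has_pd_coord 1 2 D)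
    then show ?thesis by (simp only: if_True mult_1 mult_2 refl)
  qed
  show "integrable lborel (\<lambda>x. Re (1 * ?F j x))" for j
    by (rule integrable_exp_decay) (intro continuous_intros cont exp_decay_Re exp_decay_cmult dec)+
  show "(LINT x|lborel. Re (1 * ?F j x)) = 0" for j
  proof (rule integral_pd_zero[OF pd _ cont _ dec])
    show "continuous_on UNIV (?G j)" by (intro continuous_intros D)
    show "exp_decay (?G j)"
      by (intro exp_decay_diff exp_decay_sum exp_decay_coord exp_decay_cmult exp_decay_mult[OF exp_decay_cnj] D)
  qed
  fix x
  let ?N = "\<Sum>j\<in>UNIV. (norm (pd j f x))\<^sup>2"
  \<comment> \<open>\<open>?T\<close> is half of x . grad applied to |grad f|^2. It enters with
    coefficient 2 from the first half of \<open>?F\<close> and -2 from the second, so no Hessian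
    term other than the Laplacian survives.\<close>
  let ?T = "\<Sum>j\<in>UNIV. \<Sum>k\<in>UNIV. x $ j * Re (cnj (pd k f x) * pd j (pd k f) x)"
  have S: "?S x = of_real ?N"
    by (simp only: of_real_sum complex_norm_square mult.commute)
  have "(\<Sum>j\<in>UNIV. Re (cnj (pd j f x) * ?R' j x))
      = (\<Sum>j\<in>UNIV. (\<Sum>k\<in>UNIV. x $ k * Re (cnj (pd j f x) * pd j (pd k f) x)) + (norm (pd j f x))\<^sup>2)"
  proof (rule sum.cong[OF refl])
    fix j
    have "(\<Sum>k\<in>UNIV. (if k = j then 1 else 0) * pd k f x) = (\<Sum>k\<in>UNIV. if k = j then pd k f x else 0)"
      by (rule sum.cong) auto
    then have R': "?R' j x = (\<Sum>k\<in>UNIV. of_real (x $ k) * pd j (pd k f) x) + pd j f x"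
      by (simp only: sum.distrib) simp
    have "cnj (pd j f x) * ?R' j x
      = (\<Sum>k\<in>UNIV. of_real (x $ k) * (cnj (pd j f x) * pd j (pd k f) x)) + of_real ((norm (pd j f x))\<^sup>2)"
      unfolding R' complex_norm_square by (simp add: sum_distrib_left algebra_simps)
    then show "Re (cnj (pd j f x) * ?R' j x)
      = (\<Sum>k\<in>UNIV. x $ k * Re (cnj (pd j f x) * pd j (pd k f) x)) + (norm (pd j f x))\<^sup>2"
      by (simp only: Re_sum plus_complex.sel Re_complex_of_real Re_of_real_mult)
  qed
  also have "\<dots> = ?T + ?N"
  proof -
    have Ck: "Ck 2 f" using f by (simp add: decaying_C2_def)
    \<comment> \<open>Exchanging the sums swaps the names of the indices; symmetry of the Hessian
      then restores the order of differentiation.\<close>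
    have "(\<Sum>j\<in>UNIV. \<Sum>k\<in>UNIV. x $ k * Re (cnj (pd j f x) * pd j (pd k f) x)) = ?T"
      by (subst sum.swap) (simp add: pd_commute[OF Ck])
    then show ?thesis by (simp add: sum.distrib)
  qed
  finally have 1: "(\<Sum>j\<in>UNIV. Re (cnj (pd j f x) * ?R' j x)) = ?T + ?N" .
  have 2: "(\<Sum>j\<in>UNIV. Re (of_real (x $ j) * ?S' j x)) = 2 * ?T"
    by (simp add: sum_distrib_left sum.distrib algebra_simps)
  have 3: "(\<Sum>j\<in>UNIV. Re (cnj (pd j (pd j f) x) * radial_deriv f x)) = Re (cnj (laplacian f x) * radial_deriv f x)"
    unfolding laplacian_def by (simp only: Re_sum[symmetric] sum_distrib_right cnj_sum)
  define A B C where "A j = Re (cnj (pd j f x) * ?R' j x)" and "B j = Re (cnj (pd j (pd j f) x) * radial_deriv f x)"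
    and "C j = Re (of_real (x $ j) * ?S' j x)" for j
  have "Re (1 * (2 * (a + b) - (c + of_real n))) = 2 * Re a + 2 * Re b - Re c - n" for a b c n
    by simp
  then have "Re (1 * ?F j x) = 2 * A j + 2 * B j - C j - ?N" for j
    unfolding S A_def B_def C_def .
  then have "(\<Sum>j\<in>UNIV. Re (1 * ?F j x)) = (\<Sum>j\<in>UNIV. 2 * A j + 2 * B j - C j - ?N)"
    by (intro sum.cong refl)
  also have "\<dots> = 2 * (\<Sum>j\<in>UNIV. A j) + 2 * (\<Sum>j\<in>UNIV. B j) - (\<Sum>j\<in>UNIV. C j) - real CARD('n) * ?N"
    by (simp add: sum.distrib sum_subtractf sum_distrib_left)
  also have "\<dots> = 2 * (?T + ?N) + 2 * Re (cnj (laplacian f x) * radial_deriv f x)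
      - 2 * ?T - real CARD('n) * ?N"
    unfolding A_def B_def C_def 1 2 3 ..
  finally have "(\<Sum>j\<in>UNIV. Re (1 * ?F j x)) = 2 * (?T + ?N) + 2 * Re (cnj (laplacian f x) * radial_deriv f x)
      - 2 * ?T - real CARD('n) * ?N" .
  then show "2 * Re (cnj (laplacian f x) * radial_deriv f x) - (real CARD('n) - 2) * ?N
      = (\<Sum>j\<in>UNIV. Re (1 * ?F j x))"
    by (simp only:) (simp add: algebra_simps)
qed

section \<open>Derivatives and decay of powers of the modulus\<close>

text \<open>The norm is not differentiable at 0, but its power is of order above 1 there and has
  derivative 0; elsewhere the chain rule through the norm applies.\<close>

lemma has_derivative_norm_powr:
  fixes w :: complex
  assumes "p > 0"
  shows "((\<lambda>w. norm w powr (p + 2)) has_derivative (\<lambda>h. (p + 2) * norm w powr p * (w \<bullet> h))) (at w)"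
proof (cases "w = 0")
  case True
  have "((\<lambda>h::complex. norm h powr (p + 1)) \<longlongrightarrow> 0) (at 0)"
    by (rule tendsto_zero_powrI[where b = "p + 1"]) (use assms in \<open>auto intro!: tendsto_eq_intros\<close>)
  moreover have "norm h powr (p + 2) / norm h = norm h powr (p + 1)" for h :: complex
    using powr_mult_base[of "norm h" "p + 1"] by (cases "h = 0") (auto simp: field_simps)
  ultimately show ?thesis using True by (simp add: has_derivative_at)
next
  case False
  have "((\<lambda>r. r powr (p + 2)) has_real_derivative (p + 2) * norm w powr (p + 1)) (at (norm w))"
    using has_real_derivative_powr[of "norm w" "p + 2"] False by (simp add: algebra_simps)
  from has_derivative_radial[OF this False] show ?thesis
  proof (rule has_derivative_eq_rhs)
    have "norm w powr (p + 1) = norm w powr p * norm w"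
      using powr_mult_base[of "norm w" p] by (simp add: algebra_simps)
    then show "(\<lambda>h. (p + 2) * norm w powr (p + 1) * (w \<bullet> h / norm w)) = (\<lambda>h. (p + 2) * norm w powr p * (w \<bullet> h))"
      using False by (simp add: fun_eq_iff)
  qed
qed

lemma has_real_derivative_norm_powr:
  fixes g :: "real \<Rightarrow> complex"
  assumes "p > 0" "(g has_vector_derivative g') (at t)"
  shows "((\<lambda>t. norm (g t) powr (p + 2)) has_real_derivative (p + 2) * norm (g t) powr p * Re (cnj (g t) * g')) (at t)"
proof -
  have "((\<lambda>t. norm (g t) powr (p + 2)) has_derivative (\<lambda>h. (p + 2) * norm (g t) powr p * (g t \<bullet> (h *\<^sub>R g')))) (at t)"
    using has_derivative_compose[OF assms(2)[unfolded has_vector_derivative_def] has_derivative_norm_powr[OF assms(1)]]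
    by simp
  then show ?thesis
    unfolding has_field_derivative_def
    by (rule has_derivative_eq_rhs) (auto simp: inner_complex_def algebra_simps)
qed

lemma has_real_derivative_norm_square:
  fixes g :: "real \<Rightarrow> complex"
  assumes "(g has_vector_derivative g') (at t)"
  shows "((\<lambda>t. (norm (g t))\<^sup>2) has_real_derivative 2 * Re (cnj (g t) * g')) (at t)"
proof -
  have "((\<lambda>t. g t \<bullet> g t) has_derivative (\<lambda>h. g t \<bullet> (h *\<^sub>R g') + (h *\<^sub>R g') \<bullet> g t)) (at t)"
    using assms unfolding has_vector_derivative_def by (intro has_derivative_inner)
  then show ?thesis
    unfolding has_field_derivative_def dot_square_norm
    by (rule has_derivative_eq_rhs) (auto simp: inner_complex_def algebra_simps)
qed

lemma continuous_on_norm_powr: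
  fixes f :: "'a::topological_space \<Rightarrow> 'b::real_normed_vector"
  shows "continuous_on S f \<Longrightarrow> p > 0 \<Longrightarrow> continuous_on S (\<lambda>x. norm (f x) powr p)"
  by (rule continuous_on_powr') (auto intro: continuous_intros)

lemma exp_decay_norm_powr_mult:
  fixes g :: "'a::real_normed_vector \<Rightarrow> real"
  assumes "exp_decay f" "exp_decay g" "p > 0"
  shows "exp_decay (\<lambda>x. norm (f x) powr p * g x)"
proof -
  obtain B where "B > 0" "\<And>x. norm (f x) \<le> B" using exp_decay_bounded[OF assms(1)] by blast
  then have "norm (norm (f x) powr p) \<le> B powr p" for x
    using assms(3) by (simp add: powr_mono2)
  then show ?thesis by (rule exp_decay_bounded_mult) fact
qed

lemma exp_decay_norm_powr:
  assumes "exp_decay f" "p > 0"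
  shows "exp_decay (\<lambda>x. norm (f x) powr (p + 2))"
proof -
  have "norm w powr (p + 2) = norm w powr (p + 1) * norm w" for w :: 'b
    using powr_mult_base[of "norm w" "p + 1"] by (simp add: algebra_simps)
  then show ?thesis
    using exp_decay_norm_powr_mult[OF assms(1) exp_decay_norm[OF assms(1)], of "p + 1"] assms(2) by simp
qed

text \<open>The divergence of the field x |f|^(p+2), integrated.\<close>

lemma Pohozaev_nonlinear:
  fixes f :: "real ^ 'n::finite \<Rightarrow> complex"
  assumes f: "decaying_C2 f" and p: "p > 0"
  shows "(LINT x|lborel. (p + 2) * (norm (f x) powr p * Re (cnj (f x) * radial_deriv f x))
    + real CARD('n) * norm (f x) powr (p + 2)) = 0"
proof (rule integral_sum_zero)
  note D = decaying_C2D[OF f]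
  let ?N = "\<lambda>x. norm (f x) powr (p + 2)"
  let ?D = "\<lambda>j x. (p + 2) * (norm (f x) powr p * Re (cnj (f x) * pd j f x))"
  let ?F = "\<lambda>j x. x $ j * ?D j x + ?N x"
  have cont: "continuous_on UNIV (?F j)" for j
    using p by (intro continuous_intros continuous_on_norm_powr D) auto
  have dec: "exp_decay (?F j)" for j
    by (intro exp_decay_add exp_decay_norm_powr exp_decay_coord_real exp_decay_cmult exp_decay_norm_powr_mult
        exp_decay_Re exp_decay_mult[OF exp_decay_cnj] D p)
  show "integrable lborel (?F j)" for j
    by (rule integrable_exp_decay[OF cont dec])
  show "(LINT x|lborel. ?F j x) = 0" for j
  proof (rule integral_partial_derivative_zero[OF _ _ cont _ dec])
    fix x :: "real ^ 'n"
    have "((\<lambda>h. f (x + h *\<^sub>R axis j 1)) has_vector_derivative pd j f x) (at 0)"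
      using D(11) by (simp add: has_pd_def)
    from has_real_derivative_norm_powr[OF p this]
    have N: "((\<lambda>h. ?N (x + h *\<^sub>R axis j 1)) has_real_derivative ?D j x) (at 0)"
      by (simp add: mult.assoc)
    have "((\<lambda>h. (x + h *\<^sub>R axis j 1) $ j) has_real_derivative 1) (at 0)"
      by (auto intro!: derivative_eq_intros simp: axis_def)
    from DERIV_mult[OF this N] show "((\<lambda>h. (x + h *\<^sub>R axis j 1) $ j * ?N (x + h *\<^sub>R axis j 1)) has_real_derivative ?F j x) (at 0)"
      by (simp add: algebra_simps)
  next
    show "continuous_on UNIV (\<lambda>x. x $ j * ?N x)"
      using p by (intro continuous_intros continuous_on_norm_powr D) auto
    show "exp_decay (\<lambda>x. x $ j * ?N x)"
      by (intro exp_decay_coord_real exp_decay_norm_powr D p)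
  qed
  show "(p + 2) * (norm (f x) powr p * Re (cnj (f x) * radial_deriv f x)) + real CARD('n) * ?N x
      = (\<Sum>j\<in>UNIV. ?F j x)" for x
  proof -
    have "(\<Sum>j\<in>UNIV. x $ j * Re (cnj (f x) * pd j f x)) = Re (cnj (f x) * radial_deriv f x)"
      by (simp add: radial_deriv_def sum_distrib_left sum_distrib_right sum.distrib algebra_simps)
    moreover have "(\<Sum>j\<in>UNIV. ?F j x)
        = (p + 2) * (norm (f x) powr p * (\<Sum>j\<in>UNIV. x $ j * Re (cnj (f x) * pd j f x))) + real CARD('n) * ?N x"
      unfolding sum.distrib by (simp add: sum_distrib_left algebra_simps)
    ultimately show ?thesis by simp
  qed
qed

section \<open>Linear operations on decaying twice differentiable functions\<close>

lemma pd_add: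
  assumes "f differentiable (at x)" "g differentiable (at x)"
  shows "pd i (\<lambda>x. f x + g x) x = pd i f x + pd i g x"
proof -
  obtain f' g' where *: "(f has_derivative f') (at x)" "(g has_derivative g') (at x)"
    using assms by (auto simp: differentiable_def)
  show ?thesis using pd_eq[OF has_derivative_add[OF *], of i] pd_eq[OF *(1), of i] pd_eq[OF *(2), of i] by simp
qed

lemma Ck_add: "Ck k f \<Longrightarrow> Ck k g \<Longrightarrow> Ck k (\<lambda>x. f x + g x)"
proof (induction k arbitrary: f g)
  case 0
  then show ?case by (auto intro: continuous_intros)
next
  case (Suc k)
  have "pd i (\<lambda>x. f x + g x) = (\<lambda>x. pd i f x + pd i g x)" for i
    using Suc.prems by (intro ext pd_add) auto
  moreover have "\<forall>i. Ck k (\<lambda>x. pd i f x + pd i g x)"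
    using Suc.IH Suc.prems by (meson Ck.simps(2))
  moreover have "\<forall>x. (\<lambda>x. f x + g x) differentiable (at x)"
    using Suc.prems by (simp add: differentiable_add)
  ultimately show ?case by simp
qed

lemma decaying_C2_add:
  assumes "decaying_C2 f" "decaying_C2 g"
  shows "decaying_C2 (\<lambda>x. f x + g x)" "pd i (\<lambda>x. f x + g x) = (\<lambda>x. pd i f x + pd i g x)"
    "pd j (pd i (\<lambda>x. f x + g x)) = (\<lambda>x. pd j (pd i f) x + pd j (pd i g) x)"
proof -
  have C: "Ck 2 f" "Ck 2 g" using assms by (auto simp: decaying_C2_def)
  show 1: "pd i (\<lambda>x. f x + g x) = (\<lambda>x. pd i f x + pd i g x)" for i
    by (intro ext pd_add Ck_2D(1) C)
  show 2: "pd j (pd i (\<lambda>x. f x + g x)) = (\<lambda>x. pd j (pd i f) x + pd j (pd i g) x)" for i j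
    unfolding 1 by (intro ext pd_add Ck_2D(2) C)
  show "decaying_C2 (\<lambda>x. f x + g x)"
    \<comment> \<open>The second-order equation has to be used first: the first-order one would
      rewrite inside its left-hand side.\<close>
    unfolding decaying_C2_def 2 unfolding 1
    by (intro conjI allI Ck_add C exp_decay_add decaying_C2D assms)
qed

lemma decaying_C2_bounded_linear:
  fixes f :: "real ^ 'n::finite \<Rightarrow> complex" and L :: "complex \<Rightarrow> complex"
  assumes "decaying_C2 f" and L: "bounded_linear L"
  shows "decaying_C2 (\<lambda>x. L (f x))" "pd i (\<lambda>x. L (f x)) = (\<lambda>x. L (pd i f x))"
    "pd j (pd i (\<lambda>x. L (f x))) = (\<lambda>x. L (pd j (pd i f) x))"
proof -
  have C: "Ck 2 f" using assms by (auto simp: decaying_C2_def)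
  show 1: "pd i (\<lambda>x. L (f x)) = (\<lambda>x. L (pd i f x))" for i
    by (intro ext pd_bounded_linear(1)[OF L] Ck_2D(1) C)
  show 2: "pd j (pd i (\<lambda>x. L (f x))) = (\<lambda>x. L (pd j (pd i f) x))" for i j
    unfolding 1 by (intro ext pd_bounded_linear(1)[OF L] Ck_2D(2) C)
  obtain B where B: "\<And>w. norm (L w) \<le> norm w * B" using bounded_linear.bounded[OF L] by blast
  have ed: "exp_decay (\<lambda>x. L (g x))" if "exp_decay g" for g :: "real ^ 'n \<Rightarrow> complex"
    by (rule exp_decay_mono[OF that, of _ B]) (use B in \<open>simp add: mult.commute\<close>)
  show "decaying_C2 (\<lambda>x. L (f x))"
    unfolding decaying_C2_def 2 unfolding 1
    by (intro conjI allI Ck_bounded_linear[OF L] C ed decaying_C2D assms)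
qed

lemma decaying_C2_diff:
  assumes "decaying_C2 f" "decaying_C2 g"
  shows "decaying_C2 (\<lambda>x. f x - g x)" "pd i (\<lambda>x. f x - g x) = (\<lambda>x. pd i f x - pd i g x)"
    "pd j (pd i (\<lambda>x. f x - g x)) = (\<lambda>x. pd j (pd i f) x - pd j (pd i g) x)"
    "laplacian (\<lambda>x. f x - g x) = (\<lambda>x. laplacian f x - laplacian g x)"
    "radial_deriv (\<lambda>x. f x - g x) = (\<lambda>x. radial_deriv f x - radial_deriv g x)"
proof -
  have L: "bounded_linear (uminus :: complex \<Rightarrow> complex)" by (intro bounded_linear_minus bounded_linear_ident)
  note g = decaying_C2_bounded_linear[OF assms(2) L]
  note fg = decaying_C2_add[OF assms(1) g(1)]
  show "decaying_C2 (\<lambda>x. f x - g x)" using fg(1) by simp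
  show 1: "pd i (\<lambda>x. f x - g x) = (\<lambda>x. pd i f x - pd i g x)" for i using fg(2) g(2) by simp
  show 2: "pd j (pd i (\<lambda>x. f x - g x)) = (\<lambda>x. pd j (pd i f) x - pd j (pd i g) x)" for i j using fg(3) g(3) by simp
  show "laplacian (\<lambda>x. f x - g x) = (\<lambda>x. laplacian f x - laplacian g x)"
    unfolding laplacian_def 2 by (simp add: sum_subtractf)
  show "radial_deriv (\<lambda>x. f x - g x) = (\<lambda>x. radial_deriv f x - radial_deriv g x)"
    unfolding radial_deriv_def 1 by (simp add: sum_subtractf algebra_simps)
qed

section \<open>Constancy from one-sided bounds, and auxiliary facts on integrals\<close>

text \<open>Right of each point \<open>f\<close> falls at most with arbitrarily small slope. After
  tilting by \<epsilon>, the set of times where \<open>f\<close> is not below its initial value is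
  closed, and the minorant at its supremum pushes beyond it unless that supremum is
  \<open>b\<close>.\<close>

lemma continuous_minorant_imp_le:
  fixes f :: "real \<Rightarrow> real"
  assumes cont: "\<And>s. isCont f s"
    and minor: "\<And>s. \<exists>\<phi>. (\<phi> has_real_derivative 0) (at s) \<and> (\<forall>t. f t - f s \<ge> \<phi> t - \<phi> s)"
    and ab: "a \<le> b"
  shows "f a \<le> f b"
proof (rule field_le_epsilon)
  fix e :: real assume e: "e > 0"
  \<comment> \<open>The summand 1 keeps \<epsilon> positive when \<open>a = b\<close>; the total
    loss \<epsilon> (b - a) stays below \<open>e\<close>.\<close>
  define \<epsilon> where "\<epsilon> = e / (b - a + 1)"
  have \<epsilon>: "\<epsilon> > 0" using e ab by (simp add: \<epsilon>_def)
  define S where "S = {t \<in> {a..b}. f t + \<epsilon> * (t - a) \<ge> f a}"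
  have contf: "continuous_on A f" for A using cont continuous_at_imp_continuous_on by blast
  have "closed {t \<in> {a..b}. f a \<le> f t + \<epsilon> * (t - a)}"
    by (intro continuous_on_closed_Collect_le continuous_intros contf)
  then have "closed S" by (simp add: S_def)
  moreover have aS: "a \<in> S" using ab by (simp add: S_def)
  moreover have bdd: "bdd_above S" by (auto simp: S_def intro!: bdd_aboveI[of _ b])
  ultimately have c: "Sup S \<in> S" using closed_contains_Sup[of S] by auto
  define c where "c = Sup S"
  have "c = b"
  proof (rule ccontr)
    assume "c \<noteq> b"
    then have cb: "a \<le> c" "c < b" using c by (auto simp: c_def S_def)
    obtain \<phi> where \<phi>: "(\<phi> has_real_derivative 0) (at c)" "\<And>t. f t - f c \<ge> \<phi> t - \<phi> c"
      using minor by blast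
    from \<phi>(1) have "((\<lambda>t. (\<phi> t - \<phi> c) / (t - c)) \<longlongrightarrow> 0) (at c)" by (simp add: has_field_derivative_iff)
    then have "\<forall>\<^sub>F t in at c. dist ((\<phi> t - \<phi> c) / (t - c)) 0 < \<epsilon>" using \<epsilon> by (rule tendstoD)
    then obtain d where d: "d > 0" "\<And>t. t \<noteq> c \<Longrightarrow> dist t c < d \<Longrightarrow> \<bar>(\<phi> t - \<phi> c) / (t - c)\<bar> < \<epsilon>"
      by (auto simp: eventually_at)
    define t where "t = c + min (d / 2) (b - c)"
    have t: "c < t" "t \<le> b" "dist t c < d" using d cb by (auto simp: t_def dist_real_def)
    have "\<bar>\<phi> t - \<phi> c\<bar> / (t - c) < \<epsilon>" using d(2)[of t] t by (simp add: abs_divide)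
    then have "\<bar>\<phi> t - \<phi> c\<bar> < \<epsilon> * (t - c)" using t by (simp add: divide_less_eq)
    then have "f t + \<epsilon> * (t - c) \<ge> f c" using \<phi>(2)[of t] by linarith
    moreover have "f c + \<epsilon> * (c - a) \<ge> f a" using c by (simp add: S_def c_def)
    ultimately have "f t + \<epsilon> * (t - a) \<ge> f a" by (simp add: algebra_simps)
    then have "t \<in> S" using t cb by (simp add: S_def)
    then have "t \<le> c" unfolding c_def using bdd by (rule cSup_upper)
    with t show False by simp
  qed
  then have "f a \<le> f b + \<epsilon> * (b - a)" using c by (simp add: S_def c_def)
  also have "\<epsilon> * (b - a) \<le> e" using e ab by (simp add: \<epsilon>_def divide_le_eq mult_left_mono algebra_simps)
  finally show "f a \<le> f b + e" by simp
qed

text \<open>The minorants hold on both sides of \<open>s\<close>, so the hypotheses survive the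
  reversal t to -t, and monotonicity holds in both directions.\<close>

lemma continuous_minorant_imp_const:
  fixes f :: "real \<Rightarrow> real"
  assumes cont: "\<And>s. isCont f s"
    and minor: "\<And>s. \<exists>\<phi>. (\<phi> has_real_derivative 0) (at s) \<and> (\<forall>t. f t - f s \<ge> \<phi> t - \<phi> s)"
  shows "f a = f b"
proof -
  have le: "f a \<le> f b" if "a \<le> b" for a b
    using continuous_minorant_imp_le[OF cont minor that] .
  have ge: "f b \<le> f a" if "a \<le> b" for a b
  proof -
    let ?g = "\<lambda>t. f (- t)"
    have "isCont ?g s" for s
      using isCont_o2[of s uminus f] cont by simp
    moreover have "\<exists>\<phi>. (\<phi> has_real_derivative 0) (at s) \<and> (\<forall>t. ?g t - ?g s \<ge> \<phi> t - \<phi> s)" for s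
    proof -
      obtain \<phi> where \<phi>: "(\<phi> has_real_derivative 0) (at (- s))" "\<And>t. f t - f (- s) \<ge> \<phi> t - \<phi> (- s)"
        using minor by blast
      have "((\<lambda>t. \<phi> (- t)) has_real_derivative 0 * - 1) (at s)"
        by (rule DERIV_chain2[where g = uminus]) (use \<phi> in \<open>auto intro!: derivative_eq_intros\<close>)
      with \<phi>(2) show ?thesis by (intro exI[of _ "\<lambda>t. \<phi> (- t)"]) auto
    qed
    ultimately have "?g (- b) \<le> ?g (- a)"
      by (rule continuous_minorant_imp_le) (use that in simp)
    then show ?thesis by simp
  qed
  show ?thesis using le ge by (meson linear order_antisym)
qed

text \<open>The set where \<open>f\<close> is nonzero is open and negligible, hence empty.\<close>

lemma integral_zero_imp_zero:
  fixes f :: "'a::euclidean_space \<Rightarrow> real"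
  assumes "continuous_on UNIV f" "integrable lborel f" "\<And>x. f x \<ge> 0" "(LINT x|lborel. f x) = 0"
  shows "f x = 0"
proof -
  have "AE x in lborel. f x = 0"
    using assms integral_nonneg_eq_0_iff_AE[of lborel f] by auto
  moreover have op: "open {x. f x \<noteq> 0}"
    by (intro open_Collect_neq assms continuous_intros)
  ultimately have "{x. f x \<noteq> 0} \<in> null_sets lborel"
    using AE_iff_null_sets[of "{x. f x \<noteq> 0}" lborel] by simp
  then have "negligible {x. f x \<noteq> 0}"
    by (simp add: negligible_iff_null_sets null_sets_completionI)
  then have "{x. f x \<noteq> 0} = {}" using op open_not_negligible by blast
  then show ?thesis by auto
qed

lemma integrable_grad_square:
  assumes "decaying_C2 f"
  shows "integrable lborel (\<lambda>x. \<Sum>j\<in>UNIV. (norm (pd j f x))\<^sup>2)"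
  unfolding power2_eq_square
  by (rule integrable_exp_decay)
     (intro continuous_intros exp_decay_sum exp_decay_mult exp_decay_norm decaying_C2D assms)+

lemma integrable_norm_powr:
  assumes "decaying_C2 f" "p > 0"
  shows "integrable lborel (\<lambda>x. norm (f x) powr (p + 2))"
  using assms
  by (intro integrable_exp_decay continuous_on_norm_powr exp_decay_norm_powr decaying_C2D) auto

lemma integrable_Re_mult:
  fixes f g :: "'a::euclidean_space \<Rightarrow> complex"
  assumes "continuous_on UNIV f" "\<And>x. norm (f x) \<le> B" "continuous_on UNIV g" "exp_decay g"
  shows "integrable lborel (\<lambda>x. Re (f x * g x))"
  by (rule integrable_exp_decay)
     (intro continuous_intros exp_decay_Re exp_decay_bounded_mult[of f B g] assms)+

lemma integral_eq_uminus:
  fixes g h :: "'a \<Rightarrow> real"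
  assumes "(LINT x|M. h x + g x) = 0" "integrable M h" "integrable M g"
  shows "integral\<^sup>L M g = (LINT x|M. - h x)"
  using assms by simp

lemma integral_diff_eqI:
  fixes a b g P Q :: "'a \<Rightarrow> real"
  assumes "(LINT x|M. a x - b x - g x + 2 * (P x - Q x)) = 0"
    and "integrable M a" "integrable M b" "integrable M g" "integrable M P" "integrable M Q"
  shows "integral\<^sup>L M a - integral\<^sup>L M b = integral\<^sup>L M g - 2 * (integral\<^sup>L M P - integral\<^sup>L M Q)"
  using assms by simp

section \<open>Conservation laws and the virial identity\<close>

text \<open>\<open>K\<close> and \<kappa> do not depend on \<open>t\<close>: one spatial envelope
  serves all times and yields the dominating functions for every derivative in time.\<close>

locale decaying_solution =
  fixes p K \<kappa> :: real and u :: "real \<Rightarrow> real ^ 'n::finite \<Rightarrow> complex"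
  assumes p: "p > 0" and sol: "NLS_solution p u"
    and K: "K > 0" and \<kappa>: "\<kappa> > 0"
    and bound0: "norm (u t x) \<le> K * exp (- \<kappa> * norm x)"
    and bound1: "norm (pd i (u t) x) \<le> K * exp (- \<kappa> * norm x)"
    and bound2: "norm (pd j (pd i (u t)) x) \<le> K * exp (- \<kappa> * norm x)"
begin

definition ut :: "real \<Rightarrow> real ^ 'n \<Rightarrow> complex" where
  "ut t x = vector_derivative (\<lambda>s. u s x) (at t)"

text \<open>Chosen to bound \<open>ut\<close> by the envelope: the first term covers the Laplacian,
  the second the nonlinearity. It becomes the Lipschitz constant in time.\<close>

definition L :: real where "L = real CARD('n) * K + K powr p * K"

definition I0 :: real where "I0 = (LINT x::real^'n|lborel. exp (- \<kappa> * norm x))"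

definition grad_energy :: "real \<Rightarrow> real" where
  "grad_energy t = (LINT x|lborel. (\<Sum>j\<in>UNIV. (norm (pd j (u t) x))\<^sup>2))"

definition pot_energy :: "real \<Rightarrow> real" where
  "pot_energy t = (LINT x|lborel. norm (u t x) powr (p + 2))"

definition mass :: "real \<Rightarrow> real" where
  "mass t = (LINT x|lborel. (norm (u t x))\<^sup>2)"

text \<open>Since Re(-i w) = Im w, this is the functional M of the overview.\<close>

definition virial :: "real \<Rightarrow> real" where
  "virial t = (LINT x|lborel. Re (- \<i> * (cnj (u t x) * radial_deriv (u t) x)))"

lemma C2: "decaying_C2 (u t)"
  unfolding decaying_C2_def
proof (intro conjI allI)
  show "Ck 2 (u t)" using sol by (simp add: NLS_solution_def)
qed (rule exp_decayI[OF \<kappa>], rule bound0 bound1 bound2)+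

lemma exp_le_1: "exp (- \<kappa> * norm x) \<le> 1"
  using \<kappa> by simp

lemma int_exp: "integrable lborel (\<lambda>x::real^'n. exp (- \<kappa> * norm x))"
  by (rule integrable_exp_norm[OF \<kappa>])

lemma int_exp_cmult: "integrable lborel (\<lambda>x::real^'n. c * exp (- \<kappa> * norm x))"
  by (intro integrable_mult_right int_exp)

lemma L_nonneg: "L \<ge> 0"
  using K by (simp add: L_def)

lemma bound0': "norm (u t x) \<le> K"
  using bound0[of t x] mult_left_mono[OF exp_le_1[of x], of K] K by linarith

lemma laplacian_bound: "norm (laplacian (u t) x) \<le> real CARD('n) * K * exp (- \<kappa> * norm x)"
proof -
  have "norm (laplacian (u t) x) \<le> (\<Sum>i\<in>(UNIV::'n set). K * exp (- \<kappa> * norm x))"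
    unfolding laplacian_def by (intro sum_norm_le bound2)
  then show ?thesis by simp
qed

lemma laplacian_bound': "norm (laplacian (u t) x) \<le> real CARD('n) * K"
proof -
  have "real CARD('n) * K * exp (- \<kappa> * norm x) \<le> real CARD('n) * K * 1"
    using K by (intro mult_left_mono exp_le_1) auto
  then show ?thesis using laplacian_bound[of t x] by linarith
qed

lemma ut: "((\<lambda>s. u s x) has_vector_derivative ut t x) (at t)"
  using sol unfolding ut_def NLS_solution_def by (simp add: vector_derivative_works[symmetric])

lemma ut_eq: "ut t x = \<i> * (laplacian (u t) x + nonlin p (u t x))"
proof -
  have "\<i> * ut t x + laplacian (u t) x = - nonlin p (u t x)"
    using sol by (simp add: ut_def NLS_solution_def)
  then have *: "\<i> * ut t x = - (laplacian (u t) x + nonlin p (u t x))"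
    by (simp add: eq_neg_iff_add_eq_0 algebra_simps)
  have "ut t x = - (\<i> * (\<i> * ut t x))" by simp
  also have "\<dots> = \<i> * (laplacian (u t) x + nonlin p (u t x))" unfolding * by (simp add: algebra_simps)
  finally show ?thesis .
qed

lemma ut_bound: "norm (ut t x) \<le> L * exp (- \<kappa> * norm x)"
proof -
  have "norm (u t x) powr p \<le> K powr p" using bound0' p by (intro powr_mono2) auto
  then have "norm (nonlin p (u t x)) \<le> K powr p * (K * exp (- \<kappa> * norm x))"
    unfolding nonlin_def norm_mult using bound0[of t x] K by (intro mult_mono) auto
  moreover have "norm (ut t x) \<le> norm (laplacian (u t) x) + norm (nonlin p (u t x))"
    unfolding ut_eq by (simp add: norm_mult norm_triangle_ineq)
  ultimately show ?thesis using laplacian_bound[of t x] by (simp add: L_def algebra_simps)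
qed

lemma continuous_ut: "continuous_on UNIV (ut t)"
  unfolding ut_eq[abs_def] nonlin_def
  by (intro continuous_intros continuous_on_norm_powr decaying_C2D C2 p)

lemma exp_decay_ut: "exp_decay (ut t)"
  by (rule exp_decayI[OF \<kappa> ut_bound])

lemma lipschitz: "norm (u t x - u s x) \<le> L * exp (- \<kappa> * norm x) * \<bar>t - s\<bar>"
proof -
  have "norm (u t x - u s x) \<le> L * exp (- \<kappa> * norm x) * norm (t - s)"
  proof (rule differentiable_bound[of UNIV])
    show "((\<lambda>s. u s x) has_derivative (\<lambda>h. h *\<^sub>R ut r x)) (at r within UNIV)" for r
      using ut[of x r] by (simp add: has_vector_derivative_def)
    show "onorm (\<lambda>h. h *\<^sub>R ut r x) \<le> L * exp (- \<kappa> * norm x)" for r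
      by (rule onorm_bound) (use ut_bound[of r x] L_nonneg in \<open>auto simp: mult.commute mult_left_mono\<close>)
  qed auto
  then show ?thesis by simp
qed

lemma pairing_deriv:
  assumes "continuous_on UNIV f" "\<And>x. norm (f x) \<le> B"
  shows "((\<lambda>t. LINT x|lborel. Re (f x * u t x)) has_real_derivative (LINT x|lborel. Re (f x * ut s x))) (at s)"
proof (rule has_field_derivative_integral)
  show "integrable lborel (\<lambda>x. Re (f x * u t x))" for t
    by (rule integrable_Re_mult[OF assms]) (rule decaying_C2D[OF C2])+
  show "((\<lambda>t. Re (f x * u t x)) has_real_derivative Re (f x * ut t x)) (at t)" for t x
    using bounded_linear.has_vector_derivative[OF bounded_linear_Re has_vector_derivative_mult_right[OF ut[of x t], of "f x"]]
    by (simp add: has_real_derivative_iff_has_vector_derivative)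
  show "(\<lambda>x. Re (f x * ut s x)) \<in> borel_measurable lborel"
    using borel_measurable_integrable[OF integrable_Re_mult[OF assms continuous_ut exp_decay_ut]] .
  show "\<bar>Re (f x * ut t x)\<bar> \<le> B * L * exp (- \<kappa> * norm x)" for t x
  proof -
    have "norm (f x * ut t x) \<le> B * (L * exp (- \<kappa> * norm x))"
      unfolding norm_mult using order_trans[OF norm_ge_zero assms(2)]
      by (intro mult_mono assms(2) ut_bound) auto
    then show ?thesis using abs_Re_le_cmod[of "f x * ut t x"] by simp
  qed
qed (rule int_exp_cmult)

lemma pot_energy_deriv:
  "(pot_energy has_real_derivative (LINT x|lborel. (p + 2) * (norm (u s x) powr p * Re (cnj (u s x) * ut s x)))) (at s)"
  unfolding pot_energy_def[abs_def]
proof (rule has_field_derivative_integral)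
  show "integrable lborel (\<lambda>x. norm (u t x) powr (p + 2))" for t
    by (rule integrable_norm_powr[OF C2 p])
  show "((\<lambda>t. norm (u t x) powr (p + 2)) has_real_derivative
      (p + 2) * (norm (u t x) powr p * Re (cnj (u t x) * ut t x))) (at t)" for t x
    using has_real_derivative_norm_powr[OF p ut[of x t]] by (simp add: mult.assoc)
  have "continuous_on UNIV (\<lambda>x. (p + 2) * (norm (u s x) powr p * Re (cnj (u s x) * ut s x)))"
    by (intro continuous_intros continuous_on_norm_powr decaying_C2D C2 p continuous_ut)
  then show "(\<lambda>x. (p + 2) * (norm (u s x) powr p * Re (cnj (u s x) * ut s x))) \<in> borel_measurable lborel"
    by (simp add: borel_measurable_continuous_onI)
  show "\<bar>(p + 2) * (norm (u t x) powr p * Re (cnj (u t x) * ut t x))\<bar>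
      \<le> (p + 2) * (K powr p * (K * L)) * exp (- \<kappa> * norm x)" for t x
  proof -
    have "norm (cnj (u t x) * ut t x) \<le> K * (L * exp (- \<kappa> * norm x))"
      unfolding norm_mult using bound0'[of t x] ut_bound[of t x] K by (intro mult_mono) auto
    then have "\<bar>Re (cnj (u t x) * ut t x)\<bar> \<le> K * (L * exp (- \<kappa> * norm x))"
      using abs_Re_le_cmod order_trans by blast
    moreover have "norm (u t x) powr p \<le> K powr p" using bound0' p by (intro powr_mono2) auto
    ultimately have "norm (u t x) powr p * \<bar>Re (cnj (u t x) * ut t x)\<bar> \<le> K powr p * (K * (L * exp (- \<kappa> * norm x)))"
      by (intro mult_mono) auto
    then have "(p + 2) * (norm (u t x) powr p * \<bar>Re (cnj (u t x) * ut t x)\<bar>)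
        \<le> (p + 2) * (K powr p * (K * (L * exp (- \<kappa> * norm x))))"
      using p by (intro mult_left_mono) auto
    then show ?thesis using p by (simp only: abs_mult abs_of_nonneg powr_ge_zero mult.assoc)
  qed
qed (rule int_exp_cmult)

lemma mass_deriv:
  "(mass has_real_derivative (LINT x|lborel. 2 * Re (cnj (u s x) * ut s x))) (at s)"
  unfolding mass_def[abs_def]
proof (rule has_field_derivative_integral)
  show "integrable lborel (\<lambda>x. (norm (u t x))\<^sup>2)" for t
    unfolding power2_eq_square
    by (rule integrable_exp_decay) (intro continuous_intros exp_decay_mult exp_decay_norm decaying_C2D C2)+
  show "((\<lambda>t. (norm (u t x))\<^sup>2) has_real_derivative 2 * Re (cnj (u t x) * ut t x)) (at t)" for t x
    by (rule has_real_derivative_norm_square[OF ut])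
  have "continuous_on UNIV (\<lambda>x. 2 * Re (cnj (u s x) * ut s x))"
    by (intro continuous_intros decaying_C2D C2 continuous_ut)
  then show "(\<lambda>x. 2 * Re (cnj (u s x) * ut s x)) \<in> borel_measurable lborel"
    by (simp add: borel_measurable_continuous_onI)
  show "\<bar>2 * Re (cnj (u t x) * ut t x)\<bar> \<le> 2 * K * L * exp (- \<kappa> * norm x)" for t x
  proof -
    have "norm (cnj (u t x) * ut t x) \<le> K * (L * exp (- \<kappa> * norm x))"
      unfolding norm_mult using bound0'[of t x] ut_bound[of t x] K by (intro mult_mono) auto
    then show ?thesis using abs_Re_le_cmod[of "cnj (u t x) * ut t x"] by (simp only: abs_mult)
  qed
qed (rule int_exp_cmult)

lemma mass_const: "mass s = mass t"
proof -
  have "(LINT x|lborel. 2 * Re (cnj (u s x) * ut s x)) = 0" for s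
  proof -
    \<comment> \<open>With \<open>- \<i>\<close> in front, the real gradient sum drops out of
      Green's identity; the nonlinear term drops out of the left-hand side for the same
      reason.\<close>
    have "2 * Re (cnj (u s x) * ut s x) = 2 * Re (- \<i> * (cnj (laplacian (u s) x) * u s x
        + (\<Sum>j\<in>UNIV. cnj (pd j (u s) x) * pd j (u s) x)))" for x
    proof -
      have "(\<Sum>j\<in>UNIV. cnj (pd j (u s) x) * pd j (u s) x) = of_real (\<Sum>j\<in>UNIV. (norm (pd j (u s) x))\<^sup>2)"
        by (simp only: of_real_sum complex_norm_square mult.commute)
      then show ?thesis by (simp add: ut_eq nonlin_def algebra_simps)
    qed
    then show ?thesis using Green[OF C2 C2, of "- \<i>" s s] by (simp only: integral_mult_right_zero)
  qed
  then have "(mass has_real_derivative 0) (at s)" for s using mass_deriv[of s] by simp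
  then show ?thesis by (rule DERIV_isconst_all[rule_format])
qed

definition grad_diff :: "real \<Rightarrow> real \<Rightarrow> real" where
  "grad_diff t s = (LINT x|lborel. (\<Sum>j\<in>UNIV. (norm (pd j (\<lambda>x. u t x - u s x) x))\<^sup>2))"

lemma C2_diff: "decaying_C2 (\<lambda>x. u t x - u s x)"
  by (rule decaying_C2_diff[OF C2 C2])

lemma grad_diff_nonneg: "grad_diff t s \<ge> 0"
  unfolding grad_diff_def by (intro Bochner_Integration.integral_nonneg sum_nonneg) auto

text \<open>Only one factor in Green's identity is small: the Laplacian of the difference is merely
  bounded, by 2nK, while \<open>lipschitz\<close> controls the difference itself. \<open>I0\<close>
  integrates the envelope.\<close>

lemma grad_diff_le: "grad_diff t s \<le> 2 * real CARD('n) * K * L * I0 * \<bar>t - s\<bar>"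
proof -
  let ?w = "\<lambda>x. u t x - u s x"
  let ?g = "\<lambda>x. \<Sum>j\<in>UNIV. (norm (pd j ?w x))\<^sup>2"
  let ?h = "\<lambda>x. Re (cnj (laplacian ?w x) * ?w x)"
  have lap: "norm (cnj (laplacian ?w x)) \<le> 2 * real CARD('n) * K" for x
    using laplacian_bound'[of t x] laplacian_bound'[of s x]
      norm_triangle_ineq4[of "laplacian (u t) x" "laplacian (u s) x"]
    by (simp only: complex_mod_cnj decaying_C2_diff(4)[OF C2 C2])
  have int: "integrable lborel ?h"
    by (rule integrable_Re_mult[OF _ lap]) (intro continuous_intros decaying_C2D C2_diff decaying_C2D(6)[OF C2_diff])+
  have "(LINT x|lborel. ?h x + ?g x) = 0"
  proof -
    have "Re (1 * (cnj (laplacian ?w x) * ?w x + (\<Sum>j\<in>UNIV. cnj (pd j ?w x) * pd j ?w x))) = ?h x + ?g x" for x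
    proof -
      have "(\<Sum>j\<in>UNIV. cnj (pd j ?w x) * pd j ?w x) = of_real (?g x)"
        by (simp only: of_real_sum complex_norm_square mult.commute)
      then show ?thesis by (simp only: mult_1 plus_complex.sel Re_complex_of_real)
    qed
    then show ?thesis using Green[OF C2_diff C2_diff, of 1 t s t s] by simp
  qed
  then have "grad_diff t s = (LINT x|lborel. - ?h x)"
    unfolding grad_diff_def by (rule integral_eq_uminus[OF _ int integrable_grad_square[OF C2_diff]])
  also have "\<dots> \<le> (LINT x|lborel. 2 * real CARD('n) * K * L * \<bar>t - s\<bar> * exp (- \<kappa> * norm (x :: real ^ 'n)))"
  proof (rule integral_mono)
    fix x
    have "norm (cnj (laplacian ?w x) * ?w x) \<le> (2 * real CARD('n) * K) * (L * exp (- \<kappa> * norm x) * \<bar>t - s\<bar>)"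
      unfolding norm_mult using lap[of x] lipschitz[of t x s] K by (intro mult_mono) auto
    then show "- ?h x \<le> 2 * real CARD('n) * K * L * \<bar>t - s\<bar> * exp (- \<kappa> * norm x)"
      using abs_Re_le_cmod[of "cnj (laplacian ?w x) * ?w x"] by (simp only: abs_le_iff mult.assoc mult.commute mult.left_commute) linarith
  qed (intro Bochner_Integration.integrable_minus int int_exp_cmult)+
  also have "\<dots> = 2 * real CARD('n) * K * L * I0 * \<bar>t - s\<bar>"
    by (simp add: I0_def)
  finally show ?thesis .
qed

lemma grad_energy_diff:
  "grad_energy t - grad_energy s = grad_diff t s
    - 2 * ((LINT x|lborel. Re (cnj (laplacian (u s) x) * u t x)) - (LINT x|lborel. Re (cnj (laplacian (u s) x) * u s x)))"
proof -
  let ?w = "\<lambda>x. u t x - u s x"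
  let ?a = "\<lambda>t x. \<Sum>j\<in>UNIV. (norm (pd j (u t) x))\<^sup>2"
  let ?g = "\<lambda>x. \<Sum>j\<in>UNIV. (norm (pd j ?w x))\<^sup>2"
  let ?P = "\<lambda>t x. Re (cnj (laplacian (u s) x) * u t x)"
  have intP: "integrable lborel (?P t)" for t
    by (rule integrable_Re_mult[of _ "real CARD('n) * K"])
       (use laplacian_bound' in \<open>auto intro!: continuous_intros decaying_C2D[OF C2]\<close>)
  have "(LINT x|lborel. ?a t x - ?a s x - ?g x + 2 * (?P t x - ?P s x))
     = (LINT x|lborel. Re (2 * (cnj (laplacian (u s) x) * ?w x + (\<Sum>j\<in>UNIV. cnj (pd j (u s) x) * pd j ?w x))))"
  proof (rule Bochner_Integration.integral_cong[OF refl])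
    fix x
    have "(norm a)\<^sup>2 - (norm b)\<^sup>2 - (norm (a - b))\<^sup>2 = 2 * Re (cnj b * (a - b))" for a b :: complex
      unfolding cmod_power2 by (simp add: power2_eq_square algebra_simps)
    then have "?a t x - ?a s x - ?g x = (\<Sum>j\<in>UNIV. 2 * Re (cnj (pd j (u s) x) * pd j ?w x))"
      by (simp only: sum_subtractf[symmetric] decaying_C2_diff(2)[OF C2 C2])
    then show "?a t x - ?a s x - ?g x + 2 * (?P t x - ?P s x)
      = Re (2 * (cnj (laplacian (u s) x) * ?w x + (\<Sum>j\<in>UNIV. cnj (pd j (u s) x) * pd j ?w x)))"
      by (simp only: Re_sum[symmetric] sum_distrib_left[symmetric]) (simp add: sum_distrib_left algebra_simps)
  qed
  also have "\<dots> = 0" by (rule Green[OF C2 C2_diff])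
  finally show ?thesis
    unfolding grad_energy_def grad_diff_def
    by (rule integral_diff_eqI[OF _ integrable_grad_square[OF C2] integrable_grad_square[OF C2]
          integrable_grad_square[OF C2_diff] intP intP])
qed

lemma energy_eq: "energy p (u t) = grad_energy t - 2 / (p + 2) * pot_energy t"
  by (simp add: energy_def grad_energy_def pot_energy_def)

lemma energy_diff:
  obtains \<phi> where "(\<phi> has_real_derivative 0) (at s)"
    "\<And>t. energy p (u t) - energy p (u s) = grad_diff t s + (\<phi> t - \<phi> s)"
proof
  let ?P = "\<lambda>t. LINT x|lborel. Re (cnj (laplacian (u s) x) * u t x)"
  \<comment> \<open>The pairing is the cross term of \<open>grad_energy_diff\<close>; the other term
    is the potential part of the energy.\<close>
  let ?\<phi> = "\<lambda>t. - 2 * ?P t - 2 / (p + 2) * pot_energy t"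
  have contlap: "continuous_on UNIV (\<lambda>x. cnj (laplacian (u s) x))"
    by (intro continuous_intros decaying_C2D C2)
  have P: "(?P has_real_derivative (LINT x|lborel. Re (cnj (laplacian (u s) x) * ut s x))) (at s)"
    by (rule pairing_deriv[OF contlap, of "real CARD('n) * K"]) (simp add: laplacian_bound')
  let ?D1 = "\<lambda>x. Re (cnj (laplacian (u s) x) * ut s x)"
  let ?D2 = "\<lambda>x. norm (u s x) powr p * Re (cnj (u s x) * ut s x)"
  have int1: "integrable lborel ?D1"
    by (rule integrable_Re_mult[OF contlap _ continuous_ut exp_decay_ut, of "real CARD('n) * K"]) (simp add: laplacian_bound')
  have int2: "integrable lborel ?D2"
    by (rule integrable_exp_decay)
       (intro continuous_intros continuous_on_norm_powr exp_decay_norm_powr_mult exp_decay_Re exp_decay_mult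
          exp_decay_cnj decaying_C2D C2 p continuous_ut exp_decay_ut)+
  \<comment> \<open>With W = Laplacian plus nonlinearity, the sum is Re(cnj W times i W), the real
    part of an imaginary number.\<close>
  have "?D1 x + ?D2 x = 0" for x
    by (simp add: ut_eq nonlin_def algebra_simps)
  then have "(LINT x|lborel. ?D1 x + ?D2 x) = 0" by (simp only:) simp
  then have "(LINT x|lborel. ?D1 x) + (LINT x|lborel. ?D2 x) = 0" using int1 int2 by simp
  moreover have "2 / (p + 2) * (LINT x|lborel. (p + 2) * ?D2 x) = 2 * (LINT x|lborel. ?D2 x)"
    using p unfolding integral_mult_right_zero by (simp add: field_simps)
  ultimately have "- 2 * (LINT x|lborel. ?D1 x) - 2 / (p + 2) * (LINT x|lborel. (p + 2) * ?D2 x) = 0"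
    by linarith
  moreover have "(?\<phi> has_real_derivative - 2 * (LINT x|lborel. ?D1 x) - 2 / (p + 2) * (LINT x|lborel. (p + 2) * ?D2 x)) (at s)"
    by (intro DERIV_diff DERIV_cmult P pot_energy_deriv)
  ultimately show "(?\<phi> has_real_derivative 0) (at s)" by (simp only:)
  show "energy p (u t) - energy p (u s) = grad_diff t s + (?\<phi> t - ?\<phi> s)" for t
    using grad_energy_diff[of t s] unfolding energy_eq by (simp add: algebra_simps)
qed

lemma energy_const: "energy p (u s) = energy p (u t)"
proof (rule continuous_minorant_imp_const[of "\<lambda>t. energy p (u t)"])
  fix s
  obtain \<phi> where \<phi>: "(\<phi> has_real_derivative 0) (at s)"
    "\<And>t. energy p (u t) - energy p (u s) = grad_diff t s + (\<phi> t - \<phi> s)"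
    using energy_diff by blast
  then show "\<exists>\<phi>. (\<phi> has_real_derivative 0) (at s) \<and> (\<forall>t. energy p (u t) - energy p (u s) \<ge> \<phi> t - \<phi> s)"
    using grad_diff_nonneg by (intro exI[of _ \<phi>]) auto
  \<comment> \<open>The linear bound on the remainder is used only here, for continuity; the
    minorant itself needs just its sign.\<close>
  have "((\<lambda>t. grad_diff t s) \<longlongrightarrow> 0) (at s)"
  proof (rule tendsto_sandwich[of "\<lambda>_. 0"])
    have "((\<lambda>t. 2 * real CARD('n) * K * L * I0 * \<bar>t - s\<bar>) \<longlongrightarrow> 2 * real CARD('n) * K * L * I0 * \<bar>s - s\<bar>) (at s)"
      by (intro tendsto_intros)
    then show "((\<lambda>t. 2 * real CARD('n) * K * L * I0 * \<bar>t - s\<bar>) \<longlongrightarrow> 0) (at s)" by simp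
  qed (auto simp: grad_diff_nonneg grad_diff_le intro!: always_eventually)
  moreover have "(\<phi> \<longlongrightarrow> \<phi> s) (at s)" using DERIV_isCont[OF \<phi>(1)] by (simp add: isCont_def)
  ultimately have "((\<lambda>t. energy p (u s) + grad_diff t s + (\<phi> t - \<phi> s)) \<longlongrightarrow> energy p (u s) + 0 + (\<phi> s - \<phi> s)) (at s)"
    by (intro tendsto_intros)
  then have lim: "((\<lambda>t. energy p (u s) + grad_diff t s + (\<phi> t - \<phi> s)) \<longlongrightarrow> energy p (u s)) (at s)"
    by simp
  have "energy p (u s) + grad_diff t s + (\<phi> t - \<phi> s) = energy p (u t)" for t
    using \<phi>(2)[of t] by linarith
  with lim show "isCont (\<lambda>t. energy p (u t)) s" by (simp only: isCont_def)
qed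

end

section \<open>The virial functional: derivative in time and contradiction with periodicity\<close>

lemma integral_linear_relation:
  fixes a b X x1 x2 x3 :: "'a \<Rightarrow> real"
  assumes "\<And>x. X x = \<alpha> * a x + \<beta> * b x + c1 * x1 x + c2 * x2 x + c3 * x3 x"
    and "integrable M a" "integrable M b" "integrable M x1" "integrable M x2" "integrable M x3"
    and "integral\<^sup>L M x1 = 0" "integral\<^sup>L M x2 = 0" "integral\<^sup>L M x3 = 0"
  shows "integral\<^sup>L M X = \<alpha> * integral\<^sup>L M a + \<beta> * integral\<^sup>L M b"
proof -
  have "X = (\<lambda>x. \<alpha> * a x + \<beta> * b x + c1 * x1 x + c2 * x2 x + c3 * x3 x)" using assms(1) by blast
  then show ?thesis using assms(2-) by simp
qed

lemma integral_diff_diff_eqI: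
  fixes a b P Q r :: "'a \<Rightarrow> real"
  assumes "(LINT x|M. a x - b x - (P x - Q x) - r x) = 0"
    and "integrable M a" "integrable M b" "integrable M P" "integrable M Q" "integrable M r"
  shows "integral\<^sup>L M a - integral\<^sup>L M b = (integral\<^sup>L M P - integral\<^sup>L M Q) + integral\<^sup>L M r"
  using assms by simp

lemma norm_powr_add_2: "norm w powr (p + 2) = norm w powr p * (norm w)\<^sup>2"
  by (cases "w = 0") (auto simp: powr_add powr_numeral)

text \<open>Young's inequality; the free weight is needed because the two factors are of different
  order in |t - s|.\<close>

lemma mult_le_weighted_squares:
  fixes a b \<sigma> :: real
  assumes "\<sigma> > 0"
  shows "a * b \<le> (\<sigma> * a\<^sup>2 + b\<^sup>2 / \<sigma>) / 2"
proof -
  have "0 \<le> (\<sigma> * a - b)\<^sup>2 / \<sigma>" using assms by simp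
  then show ?thesis using assms by (simp add: power2_eq_square field_simps)
qed

context decaying_solution
begin

definition virial_rest :: "real \<Rightarrow> real \<Rightarrow> real" where
  "virial_rest t s = (LINT x|lborel. Re (- \<i> * (cnj (u t x - u s x) * radial_deriv (\<lambda>x. u t x - u s x) x)))"

text \<open>The derivative of the quadratic form \<open>virial\<close> at \<open>u s\<close>.
  Integration by parts makes both cross terms multiples of cnj(x . grad u), whence the 2; the
  dimension is the divergence of x.\<close>

definition virial_weight :: "real \<Rightarrow> real ^ 'n \<Rightarrow> complex" where
  "virial_weight s x = \<i> * cnj (2 * radial_deriv (u s) x + of_nat CARD('n) * u s x)"

lemma virial_weight: "continuous_on UNIV (virial_weight s)" "exp_decay (virial_weight s)"
  unfolding virial_weight_def[abs_def]
  by (intro continuous_intros exp_decay_cmult exp_decay_cnj exp_decay_add decaying_C2D C2)+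

lemma integrable_radial_pairing:
  assumes "decaying_C2 f"
  shows "integrable lborel (\<lambda>x. Re (c * (cnj (f x) * radial_deriv f x)))"
  by (rule integrable_exp_decay)
     (intro continuous_intros exp_decay_Re exp_decay_cmult exp_decay_mult exp_decay_cnj decaying_C2D assms)+

lemma virial_diff:
  "virial t - virial s = ((LINT x|lborel. Re (virial_weight s x * u t x)) - (LINT x|lborel. Re (virial_weight s x * u s x)))
    + virial_rest t s"
  unfolding virial_def virial_rest_def
proof (rule integral_diff_diff_eqI)
  obtain B where B: "\<And>x. norm (virial_weight s x) \<le> B" using exp_decay_bounded[OF virial_weight(2)] by blast
  show "integrable lborel (\<lambda>x. Re (virial_weight s x * u t x))" for t
    by (rule integrable_Re_mult[OF virial_weight(1) B decaying_C2D(1,6)[OF C2]])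
  show "integrable lborel (\<lambda>x. Re (virial_weight s x * u s x))"
    by (rule integrable_Re_mult[OF virial_weight(1) B decaying_C2D(1,6)[OF C2]])
  \<comment> \<open>For a quadratic form, subtracting the linear part and the remainder leaves an
    integrand that vanishes only after integration: that of \<open>integral_radial_deriv\<close>
    with the difference as second function.\<close>
  have "Re (- \<i> * (cnj a * A)) - Re (- \<i> * (cnj b * B))
      - (Re (\<i> * cnj (2 * B + of_nat n * b) * a) - Re (\<i> * cnj (2 * B + of_nat n * b) * b))
      - Re (- \<i> * (cnj (a - b) * (A - B)))
    = Re (- \<i> * (cnj b * (A - B) + cnj B * (a - b) + of_nat n * cnj b * (a - b)))" for a b A B :: complex and n
    by (simp add: algebra_simps)
  from this[of "u t _" "radial_deriv (u t) _" "u s _" "radial_deriv (u s) _" "CARD('n)"]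
  show "(LINT x|lborel. Re (- \<i> * (cnj (u t x) * radial_deriv (u t) x)) - Re (- \<i> * (cnj (u s x) * radial_deriv (u s) x))
      - (Re (virial_weight s x * u t x) - Re (virial_weight s x * u s x))
      - Re (- \<i> * (cnj (u t x - u s x) * radial_deriv (\<lambda>x. u t x - u s x) x))) = 0"
    using integral_radial_deriv[OF C2[of s] C2_diff[of t s], of "- \<i>"]
    by (simp only: virial_weight_def decaying_C2_diff(5)[OF C2 C2])
qed (rule integrable_radial_pairing[OF C2] integrable_radial_pairing[OF C2_diff])+

text \<open>The half is from Young's inequality, \<open>L\<close> from the Lipschitz bound; the
  first summand pays for the weight x, the second is the constant of
  \<open>grad_diff_le\<close>.\<close>

definition rest_const :: real where
  "rest_const = L / 2 * (real CARD('n) * (2 / \<kappa>)\<^sup>2 * I0 + 2 * real CARD('n) * K * L * I0)"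

text \<open>The factor w contributes |t - s| together with an envelope that absorbs the unbounded
  weight x; the gradient of w contributes the remaining half power, in the mean-square sense of
  \<open>grad_diff_le\<close>.\<close>

lemma virial_rest_bound: "\<bar>virial_rest t s\<bar> \<le> rest_const * \<bar>t - s\<bar> * sqrt \<bar>t - s\<bar>"
proof (cases "t = s")
  case True
  then show ?thesis by (simp add: virial_rest_def)
next
  case False
  let ?w = "\<lambda>x. u t x - u s x"
  let ?g = "\<lambda>x. \<Sum>j\<in>UNIV. (norm (pd j ?w x))\<^sup>2"
  let ?r = "\<lambda>x. Re (- \<i> * (cnj (?w x) * radial_deriv ?w x))"
  \<comment> \<open>This \<sigma> balances Young's inequality: after integration one half is of
    order \<sigma>, the other of order h/\<sigma>, which is \<sigma> again.\<close>
  define h \<sigma> where "h = \<bar>t - s\<bar>" and "\<sigma> = sqrt h"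
  have h: "h > 0" "\<sigma> > 0" "h / \<sigma> = \<sigma>" using False by (auto simp: h_def \<sigma>_def real_div_sqrt)
  let ?m = "\<lambda>x. L * h / 2 * (\<sigma> * real CARD('n) * (2 / \<kappa>)\<^sup>2 * exp (- \<kappa> * norm x) + ?g x / \<sigma>)"
  have int: "integrable lborel (\<lambda>x. ?g x / \<sigma>)" "integrable lborel (\<lambda>x::real^'n. \<sigma> * real CARD('n) * (2 / \<kappa>)\<^sup>2 * exp (- \<kappa> * norm x))"
    by (intro integrable_divide_zero integrable_grad_square C2_diff int_exp_cmult)+
  have intm: "integrable lborel ?m"
    by (rule integrable_mult_right[OF Bochner_Integration.integrable_add[OF int(2,1)]])
  have bound: "\<bar>?r x\<bar> \<le> ?m x" for x
  proof -
    let ?e = "exp (- \<kappa> * norm x)"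
    \<comment> \<open>Absorbing \<open>norm x\<close> halves the rate, and squaring restores
      \<kappa>, so the result is again a multiple of the envelope.\<close>
    have "?e = (exp (- (\<kappa> / 2) * norm x))\<^sup>2" by (simp add: power2_eq_square flip: exp_add)
    moreover have "(norm x * ?e)\<^sup>2 \<le> (2 / \<kappa> * exp (- (\<kappa> / 2) * norm x))\<^sup>2"
      using norm_mult_exp_le[OF \<kappa>, of x] by (intro power_mono) auto
    ultimately have sq: "(norm x * ?e)\<^sup>2 \<le> (2 / \<kappa>)\<^sup>2 * ?e" by (simp only: power_mult_distrib)
    have coord: "(\<bar>x $ j\<bar> * ?e)\<^sup>2 \<le> (2 / \<kappa>)\<^sup>2 * ?e" for j
    proof -
      have "(\<bar>x $ j\<bar> * ?e)\<^sup>2 \<le> (norm x * ?e)\<^sup>2"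
        by (intro power_mono mult_right_mono component_le_norm_cart) auto
      with sq show ?thesis by linarith
    qed
    have "\<bar>?r x\<bar> \<le> norm (?w x) * norm (radial_deriv ?w x)"
      using abs_Re_le_cmod[of "- \<i> * (cnj (?w x) * radial_deriv ?w x)"]
      by (simp only: norm_mult norm_minus_cancel norm_ii complex_mod_cnj mult_1)
    also have "\<dots> \<le> (L * ?e * h) * (\<Sum>j\<in>UNIV. \<bar>x $ j\<bar> * norm (pd j ?w x))"
    proof (rule mult_mono)
      show "norm (radial_deriv ?w x) \<le> (\<Sum>j\<in>UNIV. \<bar>x $ j\<bar> * norm (pd j ?w x))"
        unfolding radial_deriv_def by (rule sum_norm_le) (simp add: norm_mult)
    qed (use lipschitz[of t x s] L_nonneg h in \<open>auto simp: h_def\<close>)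
    also have "\<dots> = L * h * (\<Sum>j\<in>UNIV. (\<bar>x $ j\<bar> * ?e) * norm (pd j ?w x))"
      by (simp add: sum_distrib_left algebra_simps)
    also have "\<dots> \<le> L * h * (\<Sum>j\<in>(UNIV :: 'n set). (\<sigma> * ((2 / \<kappa>)\<^sup>2 * ?e) + (norm (pd j ?w x))\<^sup>2 / \<sigma>) / 2)"
    proof (intro mult_left_mono sum_mono)
      fix j
      show "(\<bar>x $ j\<bar> * ?e) * norm (pd j ?w x) \<le> (\<sigma> * ((2 / \<kappa>)\<^sup>2 * ?e) + (norm (pd j ?w x))\<^sup>2 / \<sigma>) / 2"
        by (rule order_trans[OF mult_le_weighted_squares[OF h(2)]],
            intro divide_right_mono add_right_mono mult_left_mono coord) (use h in auto)
    qed (use L_nonneg h in auto)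
    also have "\<dots> = ?m x"
      by (simp only: sum_divide_distrib[symmetric] sum.distrib sum_constant) (simp add: algebra_simps)
    finally show ?thesis .
  qed
  have intr: "integrable lborel ?r" by (rule integrable_radial_pairing[OF C2_diff])
  have "\<bar>virial_rest t s\<bar> \<le> (LINT x|lborel. \<bar>?r x\<bar>)"
    unfolding virial_rest_def by (rule integral_abs_bound)
  also have "\<dots> \<le> (LINT x|lborel. ?m x)"
    using intr intm bound by (intro integral_mono integrable_abs)
  also have "\<dots> = L * h / 2 * (\<sigma> * real CARD('n) * (2 / \<kappa>)\<^sup>2 * I0 + grad_diff t s / \<sigma>)"
    unfolding I0_def grad_diff_def using int
    by (simp only: Bochner_Integration.integral_mult_right_zero Bochner_Integration.integral_add integral_divide_zero)
  also have "\<dots> \<le> L * h / 2 * (\<sigma> * real CARD('n) * (2 / \<kappa>)\<^sup>2 * I0 + 2 * real CARD('n) * K * L * I0 * h / \<sigma>)"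
    using grad_diff_le[of t s] h L_nonneg
    by (intro mult_left_mono add_left_mono divide_right_mono) (auto simp: h_def)
  also have "2 * real CARD('n) * K * L * I0 * h / \<sigma> = 2 * real CARD('n) * K * L * I0 * \<sigma>"
    using h(3) by (metis times_divide_eq_right)
  also have "L * h / 2 * (\<sigma> * real CARD('n) * (2 / \<kappa>)\<^sup>2 * I0 + 2 * real CARD('n) * K * L * I0 * \<sigma>) = rest_const * h * \<sigma>"
    by (simp add: rest_const_def algebra_simps)
  finally show ?thesis by (simp add: h_def \<sigma>_def)
qed

lemma virial_deriv_aux:
  "(virial has_real_derivative (LINT x|lborel. Re (virial_weight s x * ut s x))) (at s)"
proof -
  let ?V = "\<lambda>t. LINT x|lborel. Re (virial_weight s x * u t x)"
  let ?D = "LINT x|lborel. Re (virial_weight s x * ut s x)"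
  obtain B where B: "\<And>x. norm (virial_weight s x) \<le> B" using exp_decay_bounded[OF virial_weight(2)] by blast
  have "(?V has_real_derivative ?D) (at s)"
    by (rule pairing_deriv[OF virial_weight(1) B])
  then have V: "((\<lambda>t. (?V t - ?V s) / (t - s)) \<longlongrightarrow> ?D) (at s)" by (simp add: has_field_derivative_iff)
  have R: "((\<lambda>t. virial_rest t s / (t - s)) \<longlongrightarrow> 0) (at s)"
  proof (rule tendsto_rabs_zero_cancel, rule tendsto_sandwich[of "\<lambda>_. 0"])
    have "((\<lambda>t. rest_const * sqrt \<bar>t - s\<bar>) \<longlongrightarrow> rest_const * sqrt \<bar>s - s\<bar>) (at s)" by (intro tendsto_intros)
    then show "((\<lambda>t. rest_const * sqrt \<bar>t - s\<bar>) \<longlongrightarrow> 0) (at s)" by simp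
    show "\<forall>\<^sub>F t in at s. \<bar>virial_rest t s / (t - s)\<bar> \<le> rest_const * sqrt \<bar>t - s\<bar>"
    proof (rule eventually_at_filter[THEN iffD2], rule always_eventually, intro allI impI)
      fix t assume "t \<noteq> s"
      then show "\<bar>virial_rest t s / (t - s)\<bar> \<le> rest_const * sqrt \<bar>t - s\<bar>"
        using virial_rest_bound[of t s] by (simp add: divide_le_eq algebra_simps)
    qed
  qed auto
  have "((\<lambda>t. (?V t - ?V s) / (t - s) + virial_rest t s / (t - s)) \<longlongrightarrow> ?D + 0) (at s)"
    by (intro tendsto_add V R)
  then show ?thesis
    by (simp only: has_field_derivative_iff virial_diff add_divide_distrib add_0_right)
qed

text \<open>Three vanishing integrals eliminate the Laplacian and the radial derivative:
  \<open>?x1\<close> (\<open>Pohozaev\<close>), \<open>?x2\<close> (\<open>Green\<close>) and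
  \<open>?x3\<close> (\<open>Pohozaev_nonlinear\<close>), with coefficients -1, -n and -2/(p +
  2).\<close>

lemma virial_deriv:
  "(virial has_real_derivative
    2 * grad_energy s - real CARD('n) * p / (p + 2) * pot_energy s) (at s)"
proof -
  let ?n = "real CARD('n)"
  let ?a = "\<lambda>x. \<Sum>j\<in>UNIV. (norm (pd j (u s) x))\<^sup>2"
  let ?b = "\<lambda>x. norm (u s x) powr (p + 2)"
  let ?x1 = "\<lambda>x. 2 * Re (cnj (laplacian (u s) x) * radial_deriv (u s) x) - (?n - 2) * ?a x"
  let ?x2 = "\<lambda>x. Re (cnj (laplacian (u s) x) * u s x) + ?a x"
  let ?x3 = "\<lambda>x. (p + 2) * (norm (u s x) powr p * Re (cnj (u s x) * radial_deriv (u s) x)) + ?n * ?b x"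
  have inta: "integrable lborel ?a" by (rule integrable_grad_square[OF C2])
  have intb: "integrable lborel ?b" by (rule integrable_norm_powr[OF C2 p])
  have "(LINT x|lborel. Re (virial_weight s x * ut s x)) = 2 * integral\<^sup>L lborel ?a + - (?n * p / (p + 2)) * integral\<^sup>L lborel ?b"
  proof (rule integral_linear_relation[OF _ inta intb])
    fix x
    have "Re (\<i> * cnj (2 * B + of_nat n * b) * (\<i> * (l + of_real q * b)))
        = - (2 * Re (cnj l * B)) - real n * Re (cnj l * b) - 2 * (q * Re (cnj b * B)) - real n * (q * (norm b)\<^sup>2)"
      for B b l :: complex and n q
      unfolding cmod_power2 by (simp add: power2_eq_square algebra_simps)
    from this[of "radial_deriv (u s) x" "CARD('n)" "u s x" "laplacian (u s) x" "norm (u s x) powr p"]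
    have *: "Re (virial_weight s x * ut s x) = - (2 * Re (cnj (laplacian (u s) x) * radial_deriv (u s) x))
        - ?n * Re (cnj (laplacian (u s) x) * u s x)
        - 2 * (norm (u s x) powr p * Re (cnj (u s x) * radial_deriv (u s) x)) - ?n * ?b x"
      by (simp only: virial_weight_def ut_eq nonlin_def norm_powr_add_2)
    have alg: "- X - n * Y - 2 * Z - n * b = 2 * a + - (n * p / (p + 2)) * b
        + - 1 * (X - (n - 2) * a) + - n * (Y + a) + - (2 / (p + 2)) * ((p + 2) * Z + n * b)" for X Y Z a b n :: real
    proof -
      have "2 / (p + 2) * ((p + 2) * Z + n * b) = 2 * Z + 2 * n / (p + 2) * b"
        using p by (simp add: field_simps)
      moreover have "n * p / (p + 2) + 2 * n / (p + 2) = n * (p + 2) / (p + 2)"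
        by (simp only: add_divide_distrib[symmetric]) (simp add: algebra_simps)
      then have "n * p / (p + 2) + 2 * n / (p + 2) = n" using p by simp
      then have "n * p / (p + 2) * b + 2 * n / (p + 2) * b = n * b"
        by (simp only: distrib_right[symmetric])
      ultimately show ?thesis by (simp add: algebra_simps)
    qed
    show "Re (virial_weight s x * ut s x) = 2 * ?a x + - (?n * p / (p + 2)) * ?b x
        + - 1 * ?x1 x + - ?n * ?x2 x + - (2 / (p + 2)) * ?x3 x"
      unfolding * by (rule alg)
  next
    show "integrable lborel ?x1"
      by (rule Bochner_Integration.integrable_diff[OF integrable_exp_decay integrable_mult_right[OF inta]])
         (intro continuous_intros exp_decay_Re exp_decay_cmult exp_decay_mult exp_decay_cnj decaying_C2D C2)+
    show "integrable lborel ?x2"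
      by (rule Bochner_Integration.integrable_add[OF integrable_exp_decay inta])
         (intro continuous_intros exp_decay_Re exp_decay_mult exp_decay_cnj decaying_C2D C2)+
    show "integrable lborel ?x3"
      by (rule Bochner_Integration.integrable_add[OF integrable_exp_decay integrable_mult_right[OF intb]])
         (intro continuous_intros continuous_on_norm_powr exp_decay_norm_powr_mult exp_decay_Re exp_decay_cmult
            exp_decay_mult exp_decay_cnj decaying_C2D C2 p)+
    show "integral\<^sup>L lborel ?x1 = 0" by (rule Pohozaev[OF C2])
    show "integral\<^sup>L lborel ?x3 = 0" by (rule Pohozaev_nonlinear[OF C2 p])
    have "Re (1 * (cnj (laplacian (u s) x) * u s x + (\<Sum>j\<in>UNIV. cnj (pd j (u s) x) * pd j (u s) x))) = ?x2 x" for x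
    proof -
      have "(\<Sum>j\<in>UNIV. cnj (pd j (u s) x) * pd j (u s) x) = of_real (?a x)"
        by (simp only: of_real_sum complex_norm_square mult.commute)
      then show ?thesis by (simp only: mult_1 plus_complex.sel Re_complex_of_real)
    qed
    then show "integral\<^sup>L lborel ?x2 = 0" using Green[OF C2 C2, of 1 s s] by simp
  qed
  then show ?thesis using virial_deriv_aux[of s] by (simp add: grad_energy_def pot_energy_def)
qed

lemma pot_energy_nonneg: "pot_energy t \<ge> 0"
  unfolding pot_energy_def by (intro Bochner_Integration.integral_nonneg) auto

text \<open>Vanishing at time \<open>s\<close> means zero mass at \<open>s\<close>, hence at every
  time.\<close>

lemma pot_energy_zero_imp:
  assumes "pot_energy s = 0"
  shows "u t x = 0"
proof -
  have "norm (u s x) powr (p + 2) = 0" for x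
    by (rule integral_zero_imp_zero[of "\<lambda>x. norm (u s x) powr (p + 2)"])
       (use assms p in \<open>auto simp: pot_energy_def intro: integrable_norm_powr[OF C2 p] intro!: continuous_on_norm_powr decaying_C2D[OF C2]\<close>)
  then have "u s x = 0" for x by simp
  then have "mass t = 0" using mass_const[of t s] by (simp add: mass_def)
  then have "(norm (u t x))\<^sup>2 = 0"
  proof (intro integral_zero_imp_zero[of "\<lambda>x. (norm (u t x))\<^sup>2"])
    show "continuous_on UNIV (\<lambda>x. (norm (u t x))\<^sup>2)" by (intro continuous_intros decaying_C2D C2)
    show "integrable lborel (\<lambda>x. (norm (u t x))\<^sup>2)"
      unfolding power2_eq_square
      by (rule integrable_exp_decay) (intro continuous_intros exp_decay_mult exp_decay_norm decaying_C2D C2)+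
  qed (auto simp: mass_def)
  then show ?thesis by simp
qed

text \<open>At a critical time of the virial, 2E equals (np - 4)/(p + 2) times a positive number. So
  E has the sign of np - 4, which each regime excludes.\<close>

lemma not_time_periodic:
  assumes T: "T > 0" and per: "\<And>x. u T x = u 0 x" and nz: "u t1 x1 \<noteq> 0"
    and cases: "(energy p (u t0) > 0 \<and> p \<le> 4 / real CARD('n))
       \<or> (energy p (u t0) = 0 \<and> p \<noteq> 4 / real CARD('n))
       \<or> (energy p (u t0) < 0 \<and> 4 / real CARD('n) \<le> p)"
  shows False
proof -
  let ?n = "real CARD('n)"
  have "u T = u 0" using per by blast
  then have eq: "virial 0 = virial T" by (simp add: virial_def)
  from MVT2[OF T virial_deriv] obtain s where
    "virial T - virial 0 = (T - 0) * (2 * grad_energy s - ?n * p / (p + 2) * pot_energy s)" by blast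
  then have "2 * grad_energy s = ?n * p / (p + 2) * pot_energy s" using eq T by simp
  \<comment> \<open>Conservation of energy transfers the sign assumed at \<open>t0\<close> to the
    time \<open>s\<close>, over which there is no control.\<close>
  moreover have "grad_energy s = energy p (u t0) + 2 / (p + 2) * pot_energy s"
    using energy_const[of t0 s] energy_eq[of s] by simp
  ultimately have "2 * energy p (u t0) = (?n * p / (p + 2) - 4 / (p + 2)) * pot_energy s"
    by (simp add: algebra_simps)
  then have key: "2 * energy p (u t0) = (?n * p - 4) / (p + 2) * pot_energy s"
    by (simp add: diff_divide_distrib)
  have pos: "pot_energy s > 0"
    using pot_energy_nonneg[of s] pot_energy_zero_imp[of s t1 x1] nz by fastforce
  have n: "?n > 0" by simp
  from cases show False
  proof (elim disjE conjE)
    assume "energy p (u t0) > 0" "p \<le> 4 / ?n"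
    then have "(?n * p - 4) / (p + 2) \<le> 0" using p n by (simp add: field_simps)
    then have "(?n * p - 4) / (p + 2) * pot_energy s \<le> 0" using pos by (intro mult_nonpos_nonneg) auto
    then show False using key \<open>energy p (u t0) > 0\<close> by linarith
  next
    assume "energy p (u t0) = 0" "p \<noteq> 4 / ?n"
    then show False using key pos p n by (simp add: field_simps)
  next
    assume "energy p (u t0) < 0" "4 / ?n \<le> p"
    then have "(?n * p - 4) / (p + 2) \<ge> 0" using p n by (simp add: field_simps)
    then have "(?n * p - 4) / (p + 2) * pot_energy s \<ge> 0" using pos by (intro mult_nonneg_nonneg) auto
    then show False using key \<open>energy p (u t0) < 0\<close> by linarith
  qed
qed

end

section \<open>Breathers\<close>

lemma pd_scaleR_arg:
  assumes "f differentiable (at (c *\<^sub>R x))"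
  shows "pd i (\<lambda>x. f (c *\<^sub>R x)) x = c *\<^sub>R pd i f (c *\<^sub>R x)" "(\<lambda>x. f (c *\<^sub>R x)) differentiable (at x)"
proof -
  obtain f' where f': "(f has_derivative f') (at (c *\<^sub>R x))" using assms by (auto simp: differentiable_def)
  have "((\<lambda>x. c *\<^sub>R x) has_derivative (\<lambda>h. c *\<^sub>R h)) (at x)" by (auto intro!: derivative_eq_intros)
  from has_derivative_compose[OF this f'] have *: "((\<lambda>x. f (c *\<^sub>R x)) has_derivative (\<lambda>h. f' (c *\<^sub>R h))) (at x)" .
  then show "(\<lambda>x. f (c *\<^sub>R x)) differentiable (at x)" by (auto simp: differentiable_def)
  show "pd i (\<lambda>x. f (c *\<^sub>R x)) x = c *\<^sub>R pd i f (c *\<^sub>R x)"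
    using pd_eq[OF *, of i] pd_eq[OF f', of i] has_derivative_linear[OF f'] by (simp add: linear_cmul)
qed

lemma Ck_scaleR_arg: "Ck k f \<Longrightarrow> Ck k (\<lambda>x. f (c *\<^sub>R x))"
proof (induction k arbitrary: f)
  case 0
  then show ?case
    using continuous_on_compose2[of UNIV f UNIV "\<lambda>x. c *\<^sub>R x"] by (simp add: continuous_on_scaleR continuous_on_id)
next
  case (Suc k)
  have "pd i (\<lambda>x. f (c *\<^sub>R x)) = (\<lambda>x. c *\<^sub>R pd i f (c *\<^sub>R x))" for i
    using Suc.prems by (intro ext pd_scaleR_arg) auto
  moreover have "Ck k (\<lambda>x. pd i f (c *\<^sub>R x))" for i
    using Suc.prems by (intro Suc.IH) auto
  then have "\<forall>i. Ck k (\<lambda>x. c *\<^sub>R pd i f (c *\<^sub>R x))"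
    using Ck_bounded_linear[OF bounded_linear_scaleR_right] by blast
  moreover have "\<forall>x. (\<lambda>x. f (c *\<^sub>R x)) differentiable (at x)"
    using Suc.prems by (auto intro: pd_scaleR_arg(2))
  ultimately show ?case by simp
qed

lemma exp_decay_scaleR_arg:
  assumes "exp_decay f" "c > 0"
  shows "exp_decay (\<lambda>x. f (c *\<^sub>R x))"
proof -
  obtain C d where *: "d > 0" "\<And>x. norm (f x) \<le> C * exp (- d * norm x)"
    using exp_decayE[OF assms(1)] by blast
  show ?thesis
    by (rule exp_decayI[of "d * c" _ C]) (use * assms(2) *(2)[of "c *\<^sub>R _"] in \<open>auto simp: mult.assoc\<close>)
qed

lemma decaying_C2_rescaled:
  fixes Q :: "real ^ 'n::finite \<Rightarrow> real"
  assumes "ground_state p Q" "p > 0" "\<omega> > 0"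
  shows "decaying_C2 (rescaled p Q \<omega>)"
proof -
  define L where "L r = complex_of_real (\<omega> powr (1 / p) * r)" for r
  have L: "bounded_linear L"
    unfolding L_def[abs_def]
    by (intro bounded_linear_compose[OF bounded_linear_of_real] bounded_linear_mult_right)
  have C: "Ck 2 Q" using assms by (simp add: ground_state_def)
  define R where "R = (\<lambda>x. Q (sqrt \<omega> *\<^sub>R x))"
  have R: "Ck 2 R" unfolding R_def by (rule Ck_scaleR_arg[OF C])
  have eq: "rescaled p Q \<omega> = (\<lambda>x. L (R x))" by (simp add: fun_eq_iff rescaled_def L_def R_def)
  have R1: "pd i R = (\<lambda>x. sqrt \<omega> *\<^sub>R pd i Q (sqrt \<omega> *\<^sub>R x))" for i
    unfolding R_def by (intro ext pd_scaleR_arg(1) Ck_2D(1)[OF C])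
  have R2: "pd j (pd i R) = (\<lambda>x. sqrt \<omega> *\<^sub>R sqrt \<omega> *\<^sub>R pd j (pd i Q) (sqrt \<omega> *\<^sub>R x))" for i j
  proof
    fix x
    have "pd j (\<lambda>x. sqrt \<omega> *\<^sub>R pd i Q (sqrt \<omega> *\<^sub>R x)) x = sqrt \<omega> *\<^sub>R pd j (\<lambda>x. pd i Q (sqrt \<omega> *\<^sub>R x)) x"
      by (rule pd_bounded_linear(1)[OF bounded_linear_scaleR_right]) (rule pd_scaleR_arg(2)[OF Ck_2D(2)[OF C]])
    also have "pd j (\<lambda>x. pd i Q (sqrt \<omega> *\<^sub>R x)) x = sqrt \<omega> *\<^sub>R pd j (pd i Q) (sqrt \<omega> *\<^sub>R x)"
      by (rule pd_scaleR_arg(1)[OF Ck_2D(2)[OF C]])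
    finally show "pd j (pd i R) x = sqrt \<omega> *\<^sub>R sqrt \<omega> *\<^sub>R pd j (pd i Q) (sqrt \<omega> *\<^sub>R x)" unfolding R1 .
  qed
  have "pd i (rescaled p Q \<omega>) = (\<lambda>x. L (pd i R x))" for i
    unfolding eq by (intro ext pd_bounded_linear(1)[OF L] Ck_2D(1)[OF R])
  note 1 = this
  have 2: "pd j (pd i (rescaled p Q \<omega>)) = (\<lambda>x. L (pd j (pd i R) x))" for i j
    unfolding 1 by (intro ext pd_bounded_linear(1)[OF L] Ck_2D(2)[OF R])
  have dec: "exp_decay (\<lambda>x. L (b * f (sqrt \<omega> *\<^sub>R x)))" if "exp_decay f" for f :: "real ^ 'n \<Rightarrow> real" and b
    unfolding L_def
    by (intro exp_decay_of_real exp_decay_cmult exp_decay_scaleR_arg[OF that]) (use assms(3) in simp)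
  show ?thesis
    unfolding decaying_C2_def
  proof (intro conjI allI)
    show "Ck 2 (rescaled p Q \<omega>)" unfolding eq by (rule Ck_bounded_linear[OF L R])
    show "exp_decay (rescaled p Q \<omega>)"
      using dec[OF ground_state_decay(1)[OF assms(1,2)], of 1] by (simp add: eq R_def)
    show "exp_decay (pd i (rescaled p Q \<omega>))" for i
      using dec[OF ground_state_decay(2)[OF assms(1,2)], of "sqrt \<omega>" i] by (simp add: 1 R1)
    show "exp_decay (pd j (pd i (rescaled p Q \<omega>)))" for i j
      using dec[OF ground_state_decay(3)[OF assms(1,2)], of "sqrt \<omega> * sqrt \<omega>" j i]
      unfolding 2 R2 by (simp only: real_scaleR_def mult.assoc)
  qed
qed

text \<open>The sum \<open>F\<close> of all the norms is itself a decaying function; its constants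
  serve every summand.\<close>

lemma decaying_C2_common_bound:
  fixes f :: "real ^ 'n::finite \<Rightarrow> complex"
  assumes "decaying_C2 f"
  obtains C c where "C > 0" "c > 0" "\<And>x. norm (f x) \<le> C * exp (- c * norm x)"
    "\<And>i x. norm (pd i f x) \<le> C * exp (- c * norm x)"
    "\<And>i j x. norm (pd j (pd i f) x) \<le> C * exp (- c * norm x)"
proof -
  define F where "F x = norm (f x) + (\<Sum>i\<in>UNIV. norm (pd i f x)) + (\<Sum>i\<in>UNIV. \<Sum>j\<in>UNIV. norm (pd j (pd i f) x))" for x
  have "exp_decay F"
    unfolding F_def[abs_def] by (intro exp_decay_add exp_decay_sum exp_decay_norm decaying_C2D assms)
  then obtain C c where *: "C > 0" "c > 0" "\<And>x. norm (F x) \<le> C * exp (- c * norm x)"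
    by (rule exp_decayE) blast
  have nn: "(\<Sum>i\<in>UNIV. norm (pd i f x)) \<ge> 0" "(\<Sum>i\<in>UNIV. \<Sum>j\<in>UNIV. norm (pd j (pd i f) x)) \<ge> 0" for x
    by (intro sum_nonneg norm_ge_zero)+
  have le1: "norm (pd i f x) \<le> (\<Sum>i\<in>UNIV. norm (pd i f x))" for i x
    by (rule member_le_sum) auto
  have le2: "norm (pd j (pd i f) x) \<le> (\<Sum>i\<in>UNIV. \<Sum>j\<in>UNIV. norm (pd j (pd i f) x))" for i j x
  proof -
    have "norm (pd j (pd i f) x) \<le> (\<Sum>j\<in>UNIV. norm (pd j (pd i f) x))"
      by (rule member_le_sum) auto
    also have "\<dots> \<le> (\<Sum>i\<in>UNIV. \<Sum>j\<in>UNIV. norm (pd j (pd i f) x))"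
      by (rule member_le_sum[of _ _ "\<lambda>i. \<Sum>j\<in>UNIV. norm (pd j (pd i f) x)"]) (auto intro: sum_nonneg)
    finally show ?thesis .
  qed
  have F: "F x \<le> C * exp (- c * norm x)" for x using *(3)[of x] by simp
  show ?thesis
  proof (rule that[OF *(1,2)])
    show "norm (f x) \<le> C * exp (- c * norm x)" for x
      using F[of x] nn[of x] unfolding F_def by linarith
    show "norm (pd i f x) \<le> C * exp (- c * norm x)" for i x
      using F[of x] nn[of x] le1[of i x] norm_ge_zero[of "f x"] unfolding F_def by linarith
    show "norm (pd j (pd i f) x) \<le> C * exp (- c * norm x)" for i j x
      using F[of x] nn[of x] le2[of j i x] norm_ge_zero[of "f x"] unfolding F_def by linarith
  qed
qed

text \<open>The phase has modulus 1 and does not depend on \<open>x\<close>, so derivatives of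
  \<open>u t\<close> inherit the bounds of the rescaled ground state plus those of \<open>z\<close>:
  constants add, the smaller rate wins.\<close>

lemma breather_imp_decaying_solution:
  fixes Q :: "real ^ 'n::finite \<Rightarrow> real"
  assumes "p > 0" "ground_state p Q" "breather p Q u"
  obtains K \<kappa> T where "decaying_solution p K \<kappa> u" "T > 0" "\<And>x. u T x = u 0 x"
proof -
  obtain \<omega> C \<gamma> z where \<omega>: "\<omega> > 0" and C: "C > 0" "\<gamma> > 0" and sol: "NLS_solution p u"
    and u: "\<And>t x. u t x = exp (\<i> * complex_of_real (\<omega> * t)) * (rescaled p Q \<omega> x + z t x)"
    and z: "perturbation_solution p Q \<omega> z"
    and per: "\<And>t x. u (t + 2 * pi / \<omega>) x = u t x"
    and bd: "\<And>\<alpha> t x. length \<alpha> \<le> 2 \<Longrightarrow> norm (pd_iter \<alpha> (z t) x) \<le> C * exp (- \<gamma> * norm x)"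
    using assms(3) unfolding breather_def by blast
  have Q: "decaying_C2 (rescaled p Q \<omega>)" by (rule decaying_C2_rescaled[OF assms(2,1) \<omega>])
  have zb: "norm (z t x) \<le> C * exp (- \<gamma> * norm x)" "norm (pd i (z t) x) \<le> C * exp (- \<gamma> * norm x)"
    "norm (pd j (pd i (z t)) x) \<le> C * exp (- \<gamma> * norm x)" for t x i j
    \<comment> \<open>The head of the list is differentiated last, so \<open>[j, i]\<close> stands
      for \<open>pd j (pd i (z t))\<close>.\<close>
    using bd[of "[]" t x] bd[of "[i]" t x] bd[of "[j, i]" t x] by auto
  have Z: "decaying_C2 (z t)" for t
    unfolding decaying_C2_def
    using z zb C(2) by (auto simp: perturbation_solution_def intro!: exp_decayI)
  obtain D d where D: "D > 0" "d > 0" and Qb: "\<And>x. norm (rescaled p Q \<omega> x) \<le> D * exp (- d * norm x)"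
    "\<And>i x. norm (pd i (rescaled p Q \<omega>) x) \<le> D * exp (- d * norm x)"
    "\<And>i j x. norm (pd j (pd i (rescaled p Q \<omega>)) x) \<le> D * exp (- d * norm x)"
    using decaying_C2_common_bound[OF Q] by blast
  have add: "norm (exp (\<i> * complex_of_real (\<omega> * t)) * (a + b)) \<le> (C + D) * exp (- min \<gamma> d * norm x)"
    if "norm a \<le> D * exp (- d * norm x)" "norm b \<le> C * exp (- \<gamma> * norm x)" for a b t and x :: "real ^ 'n"
  proof -
    have "D * exp (- d * norm x) \<le> D * exp (- min \<gamma> d * norm x)"
      using D by (simp add: mult_right_mono)
    moreover have "C * exp (- \<gamma> * norm x) \<le> C * exp (- min \<gamma> d * norm x)"
      using C by (simp add: mult_right_mono)
    moreover have "norm (exp (\<i> * complex_of_real (\<omega> * t)) * (a + b)) \<le> norm a + norm b"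
      by (simp add: norm_mult norm_triangle_ineq)
    ultimately show ?thesis using that by (simp add: algebra_simps)
  qed
  have pd1: "pd i (u t) = (\<lambda>x. exp (\<i> * complex_of_real (\<omega> * t)) * (pd i (rescaled p Q \<omega>) x + pd i (z t) x))"
    and pd2: "pd j (pd i (u t)) = (\<lambda>x. exp (\<i> * complex_of_real (\<omega> * t)) * (pd j (pd i (rescaled p Q \<omega>)) x + pd j (pd i (z t)) x))"
    for i j t
  proof -
    have ut: "u t = (\<lambda>x. exp (\<i> * complex_of_real (\<omega> * t)) * (rescaled p Q \<omega> x + z t x))" using u by blast
    note s = decaying_C2_add[OF Q Z[of t]]
    note l = decaying_C2_bounded_linear[OF s(1) bounded_linear_mult_right[of "exp (\<i> * complex_of_real (\<omega> * t))"]]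
    show "pd i (u t) = (\<lambda>x. exp (\<i> * complex_of_real (\<omega> * t)) * (pd i (rescaled p Q \<omega>) x + pd i (z t) x))"
      unfolding ut l(2) s(2) ..
    show "pd j (pd i (u t)) = (\<lambda>x. exp (\<i> * complex_of_real (\<omega> * t)) * (pd j (pd i (rescaled p Q \<omega>)) x + pd j (pd i (z t)) x))"
      unfolding ut l(3) s(3) ..
  qed
  have "decaying_solution p (C + D) (min \<gamma> d) u"
  proof
    show "norm (u t x) \<le> (C + D) * exp (- min \<gamma> d * norm x)" for t x
      unfolding u by (rule add[OF Qb(1) zb(1)])
    show "norm (pd i (u t) x) \<le> (C + D) * exp (- min \<gamma> d * norm x)" for t x i
      unfolding pd1 by (rule add[OF Qb(2) zb(2)])
    show "norm (pd j (pd i (u t)) x) \<le> (C + D) * exp (- min \<gamma> d * norm x)" for t x i j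
      unfolding pd2 by (rule add[OF Qb(3) zb(3)])
  qed (use assms(1) sol C D in auto)
  moreover have "2 * pi / \<omega> > 0" using \<omega> by simp
  moreover have "u (2 * pi / \<omega>) x = u 0 x" for x using per[of 0 x] by simp
  ultimately show ?thesis by (rule that)
qed

theorem theorem2p2:
  fixes p t0 :: real
    and Q :: "real ^ 'n::finite \<Rightarrow> real"
    and u :: "real \<Rightarrow> real ^ 'n \<Rightarrow> complex"
  assumes "0 < p" and "ereal p < crit_exponent CARD('n)"
    and "ground_state p Q"
    and "NLS_solution p u"
    and "\<exists>t x. u t x \<noteq> 0"
    and "momentum (u t0) = 0"
    and "(energy p (u t0) > 0 \<and> p \<le> 4 / real CARD('n))
       \<or> (energy p (u t0) = 0 \<and> p \<noteq> 4 / real CARD('n))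
       \<or> (energy p (u t0) < 0 \<and> 4 / real CARD('n) \<le> p \<and> ereal p < crit_exponent CARD('n))"
  shows "\<not> breather p Q u"
proof
  assume "breather p Q u"
  then obtain K \<kappa> T where sol: "decaying_solution p K \<kappa> u" and T: "T > 0" "\<And>x. u T x = u 0 x"
    using breather_imp_decaying_solution[OF assms(1,3)] by blast
  obtain t x where "u t x \<noteq> 0" using assms(5) by blast
  from decaying_solution.not_time_periodic[OF sol T this] show False
    using assms(7) by blast
qed

end
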